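(* Let $k\ge 3$, let $p_1<p_2<\cdots<p_k$ be primes, $q=\prod_{i=1}^kp_i$, let $m_i\ge 2$ and $0\le n_i\le m_i-1$ be integers ($1\le i\le k$), $m=\sum_{i=1}^km_i$, $L=\prod_{i=1}^kp_i^{m_i}$, $K=\prod_{i=1}^kp_i^{n_i+1}$, and $\mathcal{V}_L=\mathbf{Z}_{p_1}^{m_1}\times\cdots\times\mathbf{Z}_{p_k}^{m_k}$. Put $B_i=\{m_1+\cdots+m_{i-1}+1,\dots,m_1+\cdots+m_i\}$ and let $J_i\subset B_i$ with $|J_i|=n_i$. Let $f_{i,j},f_{i,j}':\mathbb{Z}_q\to\mathbb{Z}_q$ ($i=1,\dots,k$, $j=1,\dots,m_i-n_i-1$) be functions. For any choice of functions $g_{i,j'},f_{i'},h_{i'}:\mathbb{Z}_q\to\mathbb{Z}_q$ ($j'=1,\dots,m_i-n_i$, $i'=1,\dots,k-1$), of one-to-one mappings $\pi_i^c:\{1,\dots,m_i-n_i\}\to B_i\setminus J_i$ (for each $i$ and each $\mathbf{c}\in\mathbf{Z}_{p_1}^{n_1}\times\cdots\times\mathbf{Z}_{p_k}^{n_k}$), and of $\lambda_{i'}\in\mathbb{Z}_q$, let $f:\mathcal{V}_L\to\mathbb{Z}_q$ be the function whose restriction to $\mathbf{x}_J=\mathbf{c}$, for each $\mathbf{c}$, is $$f|_{\mathbf{x}_J=\mathbf{c}}=\sum_{i=1}^k\Big(\frac{q}{p_i}\sum_{j=1}^{m_i-n_i-1}f_{i,j}(x_{\pi_i^c(j)})f_{i,j}'(x_{\pi_i^c(j+1)})+\sum_{j'=1}^{m_i-n_i}g_{i,j'}(x_{\pi_i^c(j')})\Big)+\sum_{i'=1}^{k-1}\lambda_{i'}f_{i'}(x_{\pi_{i'}^c(m_{i'}-n_{i'})})h_{i'}(x_{\pi_{i'+1}^c(1)}).$$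 For $0\le t<K$, let $$C_t=\Big\{f+\sum_{i=1}^k\frac{q}{p_i}\Big((\mathbf{d}_i+\mathbf{t}_i)\cdot{\mathbf{x}_i}_{J_i}+d_{i,n_i+1}x_{\pi_i(1)}+t_{i,n_i+1}x_{\pi_i(m_i-n_i)}\Big):\ \mathbf{d}_i\in\mathbf{Z}_{p_i}^{n_i},\ d_{i,n_i+1}\in\mathbf{Z}_{p_i},\ i=1,\dots,k\Big\},$$ where $\pi_i=\pi_i^c$ whenever $\mathbf{x}_J=\mathbf{c}$, and let $\psi(C_t)$ be the corresponding code of sequences $\psi(F)$, $F\in C_t$. Then the set of codes $\mathcal{C}=\{\psi(C_t): 0\le t<K\}$ forms $(K,L)$-CCCs if and only if $f_{i,j}$ and $f_{i,j}'$ permute the set $\mathbf{Z}_{p_i}$ under modulo $p_i$ for all $i=1,\dots,k$ and $j=1,\dots,m_i-n_i-1$.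
   Context: $\mathbb{Z}_q$ is the ring of integers modulo $q$, with elements represented by $0,1,\dots,q-1$; for $p\mid q$, $\mathbf{Z}_p=\{0,1,\dots,p-1\}\subset\mathbb{Z}_q$ (as a subset); arithmetic in values of $q$-ary functions is modulo $q$. $\xi_q=\exp(2\pi\sqrt{-1}/q)$. A function $\phi:\mathbb{Z}_q\to\mathbb{Z}_q$ permutes $\mathbf{Z}_p$ under modulo $p$ if the map $u\mapsto \phi(u)\bmod p$ is a bijection from $\mathbf{Z}_p$ to $\mathbf{Z}_p$. Variables and restriction: $\mathbf{x}=(\mathbf{x}_1,\dots,\mathbf{x}_k)=(x_1,\dots,x_m)$ with $\mathbf{x}_i=(x_{m_1+\cdots+m_{i-1}+1},\dots,x_{m_1+\cdots+m_i})\in\mathbf{Z}_{p_i}^{m_i}$; ${\mathbf{x}_i}_{J_i}$ is the vector of the variables with (listed) indices in $J_i$, and $\mathbf{x}_J=({\mathbf{x}_1}_{J_1},\dots,{\mathbf{x}_k}_{J_k})$. The superscript $c$ of $\pi_i^c$ is the integer label of the vector $\mathbf{c}=(\mathbf{c}_1,\dots,\mathbf{c}_k)$, $\mathbf{c}_i=(c_{i,1},\dots,c_{i,n_i})$, namely $c=\sum_{i=1}^k c_i\prod_{\alpha<i}p_\alpha^{n_\alpha}$ with $c_i=\sum_{j=1}^{n_i}c_{i,j}p_i^{j-1}$. The convention "$\pi_i=\pi_i^c$ whenever $\mathbf{x}_J=\mathbf{c}$" means that e.g. $x_{\pi_i(1)}$ denotes the function of $\mathbf{x}$ equal to $x_{\pi_i^c(1)}$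 at points with $\mathbf{x}_J=\mathbf{c}$. Indexing of codes: $t=t_1+\sum_{\beta=2}^kt_\beta\prod_{\alpha=1}^{\beta-1}p_\alpha^{n_\alpha+1}$ with $t_u=\sum_{v=1}^{n_u+1}t_{u,v}p_u^{v-1}$, $t_{u,v}\in\mathbf{Z}_{p_u}$; $\mathbf{t}_i=(t_{i,1},\dots,t_{i,n_i})$, $\mathbf{d}_i=(d_{i,1},\dots,d_{i,n_i})$; $\cdot$ is the inner product. Sequence of a function: for $F:\mathcal{V}_L\to\mathbb{Z}_q$, $\psi(F)=(\xi_q^{F_0},\dots,\xi_q^{F_{L-1}})$, where $F_x=F(\mathbf{x})$ and $\mathbf{x}\in\mathcal{V}_L$ is determined by $x=\sum_{i=1}^k\sigma_i\prod_{\alpha<i}p_\alpha^{m_\alpha}$ with $\sigma_i=\sum_{j=1}^{m_i}x_{m_1+\cdots+m_{i-1}+j}\,p_i^{j-1}$. Aperiodic correlation: for complex sequences $\mathbf{a},\mathbf{b}$ of length $L$ and an integer $\tau$ with $|\tau|<L$, $\Theta(\mathbf{a},\mathbf{b})(\tau)=\sum_{s=0}^{L-\tau-1}a_s b_{s+\tau}^*$ if $0\le\tau<L$, and $\Theta(\mathbf{a},\mathbf{b})(\tau)=\sum_{s=0}^{L+\tau-1}a_{s-\tau}b_s^*$ if $-L<\tau<0$. A code is an ordered tuple of $M$ complex sequences of length $L$; for codes $\mathbf{C}=(\mathbf{c}^1,\dots,\mathbf{c}^M)$, $\mathbf{D}=(\mathbf{d}^1,\dots,\mathbf{d}^M)$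 put $\Theta(\mathbf{C},\mathbf{D})(\tau)=\sum_{\ell=1}^M\Theta(\mathbf{c}^\ell,\mathbf{d}^\ell)(\tau)$. Here each code $\psi(C_t)$ is regarded as a tuple of sequences indexed by $(\mathbf{d}_i,d_{i,n_i+1})_{i=1}^k$, in the same order for all $t$. $(M,L)$-CCCs (complete complementary codes): a family of $M$ codes $\mathbf{C}_1,\dots,\mathbf{C}_M$, each consisting of $M$ sequences of length $L$, such that $\Theta(\mathbf{C}_{k_1},\mathbf{C}_{k_2})(\tau)=ML$ if $\tau=0$ and $k_1=k_2$; $=0$ if $0<|\tau|<L$ and $k_1=k_2$; and $=0$ if $|\tau|<L$ and $k_1\ne k_2$. *)

theory Defs
  imports "HOL-Analysis.Analysis" "HOL-Computational_Algebra.Primes" "HOL-Library.FuncSet"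
begin

text \<open>
  The ring of integers modulo \<open>q\<close> is represented by the set \<open>{..<q}\<close> of natural numbers, and its
  subset of residues \<open>0, \<dots>, p - 1\<close> by \<open>{..<p}\<close>; values of functions into it are reduced by
  \<open>mod q\<close>. All blocks, coordinates and positions are numbered from 1; entries of
  sequences, sequences of a code, and codes of a family are numbered from 0.
\<close>

subsection \<open>Mixed-radix labels\<close>

text \<open>
  A vector with \<open>k\<close> blocks, the \<open>i\<close>-th of which has \<open>e i\<close> entries in \<open>{..<p i}\<close>.
\<close>

definition block_vecs :: "nat \<Rightarrow> (nat \<Rightarrow> nat) \<Rightarrow> (nat \<Rightarrow> nat) \<Rightarrow> (nat \<Rightarrow> nat \<Rightarrow> nat) set" where
  "block_vecs k p e = (\<Pi>\<^sub>E i\<in>{1..k}. \<Pi>\<^sub>E j\<in>{1..e i}. {..<p i})"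

definition label :: "nat \<Rightarrow> (nat \<Rightarrow> nat) \<Rightarrow> (nat \<Rightarrow> nat) \<Rightarrow> (nat \<Rightarrow> nat \<Rightarrow> nat) \<Rightarrow> nat" where
  "label k p e v =
     (\<Sum>i=1..k. (\<Sum>j=1..e i. v i j * p i ^ (j - 1)) * (\<Prod>\<alpha>=1..<i. p \<alpha> ^ e \<alpha>))"

definition unlabel :: "nat \<Rightarrow> (nat \<Rightarrow> nat) \<Rightarrow> (nat \<Rightarrow> nat) \<Rightarrow> nat \<Rightarrow> (nat \<Rightarrow> nat \<Rightarrow> nat)" where
  "unlabel k p e = the_inv_into (block_vecs k p e) (label k p e)"

subsection \<open>The domain, with coordinates numbered consecutively through the blocks\<close>

definition offset :: "(nat \<Rightarrow> nat) \<Rightarrow> nat \<Rightarrow> nat" where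
  "offset m i = (\<Sum>\<alpha>=1..<i. m \<alpha>)"

definition block :: "(nat \<Rightarrow> nat) \<Rightarrow> nat \<Rightarrow> nat set" where
  "block m i = {offset m i + 1..offset m i + m i}"

definition points :: "nat \<Rightarrow> (nat \<Rightarrow> nat) \<Rightarrow> (nat \<Rightarrow> nat) \<Rightarrow> (nat \<Rightarrow> nat) set" where
  "points k p m =
     {x \<in> extensional {1..\<Sum>i=1..k. m i}. \<forall>i\<in>{1..k}. \<forall>s\<in>block m i. x s < p i}"

definition point_label :: "nat \<Rightarrow> (nat \<Rightarrow> nat) \<Rightarrow> (nat \<Rightarrow> nat) \<Rightarrow> (nat \<Rightarrow> nat) \<Rightarrow> nat" where
  "point_label k p m x = label k p m (\<lambda>i j. x (offset m i + j))"

definition point_of :: "nat \<Rightarrow> (nat \<Rightarrow> nat) \<Rightarrow> (nat \<Rightarrow> nat) \<Rightarrow> nat \<Rightarrow> (nat \<Rightarrow> nat)" where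
  "point_of k p m = the_inv_into (points k p m) (point_label k p m)"

subsection \<open>Sequences, correlations, complete complementary codes\<close>

definition root_of_unity :: "nat \<Rightarrow> complex" where
  "root_of_unity q = exp (2 * complex_of_real pi * \<i> / of_nat q)"

definition psi :: "nat \<Rightarrow> (nat \<Rightarrow> nat) \<Rightarrow> (nat \<Rightarrow> nat) \<Rightarrow> ((nat \<Rightarrow> nat) \<Rightarrow> nat) \<Rightarrow> complex list" where
  "psi k p m F =
     map (\<lambda>l. root_of_unity (\<Prod>i=1..k. p i) ^ F (point_of k p m l)) [0..<\<Prod>i=1..k. p i ^ m i]"

text \<open>Both arguments are meant to have the same length \<open>L\<close>, and \<open>\<bar>\<tau>\<bar> < L\<close>.\<close>

definition correlation :: "complex list \<Rightarrow> complex list \<Rightarrow> int \<Rightarrow> complex" where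
  "correlation a b \<tau> =
     (if 0 \<le> \<tau> then \<Sum>s<length a - nat \<tau>. a ! s * cnj (b ! (s + nat \<tau>))
      else \<Sum>s<length a - nat (-\<tau>). a ! (s + nat (-\<tau>)) * cnj (b ! s))"

definition code_correlation :: "complex list list \<Rightarrow> complex list list \<Rightarrow> int \<Rightarrow> complex" where
  "code_correlation C D \<tau> = (\<Sum>l<length C. correlation (C ! l) (D ! l) \<tau>)"

definition is_CCC :: "nat \<Rightarrow> nat \<Rightarrow> complex list list list \<Rightarrow> bool" where
  "is_CCC M L Cs \<longleftrightarrow>
     length Cs = M \<and>
     (\<forall>C\<in>set Cs. length C = M \<and> (\<forall>a\<in>set C. length a = L)) \<and>
     (\<forall>r<M. \<forall>s<M. \<forall>\<tau>. \<bar>\<tau>\<bar> < int L \<longrightarrow>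
        code_correlation (Cs ! r) (Cs ! s) \<tau> = (if r = s \<and> \<tau> = 0 then of_nat (M * L) else 0))"

subsection \<open>The codes built from a function\<close>

definition permutes_mod :: "nat \<Rightarrow> (nat \<Rightarrow> nat) \<Rightarrow> bool" where
  "permutes_mod p \<phi> \<longleftrightarrow> bij_betw (\<lambda>u. \<phi> u mod p) {..<p} {..<p}"

text \<open>
  \<open>jl i 1, \<dots>, jl i (n i)\<close> lists the indices of the restricted variables of block \<open>i\<close>;
  \<open>\<pi> i c\<close> is the mapping for the integer label \<open>c\<close> of the restricted values.
  \<open>t\<close> and \<open>d\<close> are vectors whose \<open>i\<close>-th block has \<open>n i + 1\<close> entries.
\<close>

definition code_function ::
  "nat \<Rightarrow> (nat \<Rightarrow> nat) \<Rightarrow> (nat \<Rightarrow> nat) \<Rightarrow> (nat \<Rightarrow> nat) \<Rightarrow> (nat \<Rightarrow> nat \<Rightarrow> nat) \<Rightarrow>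
   (nat \<Rightarrow> nat \<Rightarrow> nat \<Rightarrow> nat) \<Rightarrow> ((nat \<Rightarrow> nat) \<Rightarrow> nat) \<Rightarrow>
   (nat \<Rightarrow> nat \<Rightarrow> nat) \<Rightarrow> (nat \<Rightarrow> nat \<Rightarrow> nat) \<Rightarrow> (nat \<Rightarrow> nat) \<Rightarrow> nat" where
  "code_function k p m n jl \<pi> f t d x =
     (let q = \<Prod>i=1..k. p i;
          c = label k p n (\<lambda>i j. x (jl i j))
      in (f x + (\<Sum>i=1..k. q div p i *
             ((\<Sum>j=1..n i. (d i j + t i j) * x (jl i j))
              + d i (n i + 1) * x (\<pi> i c 1)
              + t i (n i + 1) * x (\<pi> i c (m i - n i))))) mod q)"

text \<open>
  The sequences of a code are ordered by the label of \<open>d\<close>, the codes of the family by that of \<open>t\<close>.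
\<close>

definition code ::
  "nat \<Rightarrow> (nat \<Rightarrow> nat) \<Rightarrow> (nat \<Rightarrow> nat) \<Rightarrow> (nat \<Rightarrow> nat) \<Rightarrow> (nat \<Rightarrow> nat \<Rightarrow> nat) \<Rightarrow>
   (nat \<Rightarrow> nat \<Rightarrow> nat \<Rightarrow> nat) \<Rightarrow> ((nat \<Rightarrow> nat) \<Rightarrow> nat) \<Rightarrow> nat \<Rightarrow> complex list list" where
  "code k p m n jl \<pi> f t =
     map (\<lambda>d. psi k p m (code_function k p m n jl \<pi> f
                (unlabel k p (\<lambda>i. n i + 1) t) (unlabel k p (\<lambda>i. n i + 1) d)))
       [0..<\<Prod>i=1..k. p i ^ (n i + 1)]"

definition codes ::
  "nat \<Rightarrow> (nat \<Rightarrow> nat) \<Rightarrow> (nat \<Rightarrow> nat) \<Rightarrow> (nat \<Rightarrow> nat) \<Rightarrow> (nat \<Rightarrow> nat \<Rightarrow> nat) \<Rightarrow>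
   (nat \<Rightarrow> nat \<Rightarrow> nat \<Rightarrow> nat) \<Rightarrow> ((nat \<Rightarrow> nat) \<Rightarrow> nat) \<Rightarrow> complex list list list" where
  "codes k p m n jl \<pi> f = map (code k p m n jl \<pi> f) [0..<\<Prod>i=1..k. p i ^ (n i + 1)]"

end

theory Submission
  imports Defs
begin

text \<open>
  Summing over the sequences of a code removes all pairs of points that differ in a restricted
  variable or at the start of a path, and Fourier inversion over the labels \<open>t\<close>, \<open>t'\<close> of the two
  codes prescribes the restricted variables and the ends of the paths. Hence the codes are
  complete complementary iff, for all restricted values and all \<open>\<tau> \<noteq> 0\<close>, the sum of
  \<open>\<omega>^(f x - f y)\<close> vanishes over the pairs at label distance \<open>\<tau>\<close> with equal starts and prescribed ends.

  These sums are built up by adding the variables one at a time along the paths. The term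
  coupling two blocks only contributes a phase, since the first variables of \<open>x\<close> and \<open>y\<close> agree. An edge
  multiplies by the matrix with entries \<open>exp (2 \<pi> \<i> \<phi> u \<phi>' v / p)\<close>, and the vanishing holds
  after this step iff it held before and the columns of the matrix are orthogonal: digit
  differences that sum to label distance zero are all zero, so at the appropriate distance only the new
  variable can differ. Finally, the columns are orthogonal iff \<open>\<phi>\<close> and \<open>\<phi>'\<close> permute the residues mod \<open>p\<close>.
\<close>

subsection \<open>Roots of unity\<close>

text \<open>For the last variable of a path, let N(\<tau>) be the matrix of correlations at distance
  \<tau>, indexed by its prescribed values u, u' in x and y. An edge with matrix M multiplies N from
  the left by the transpose of M and from the right by its conjugate, the entry for new end values
  a, b being taken at the distance \<tau> lowered by (b - a) times the place value of the new
  variable. The obstacle is that this lowered distance can be zero, where vanishing says nothing.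
  But N(0) is known exactly: it is a multiple of the identity, and the entry becomes a multiple of
  the inner product of columns a and b. Undoing the step means inverting M on both sides, which
  calls for orthogonal rows; these come from the symmetry of the permutation criterion in \<phi> and
  \<phi>'. As every step is an equivalence, a defective edge cannot be compensated by later ones.
  Since the paths vary with the restricted values while the edge matrices do not, the induction runs
  over abstract positions (block, step) instead of coordinates.\<close>

lemma root_of_unity_power: "root_of_unity n ^ j = exp (2 * of_real pi * \<i> * of_nat j / of_nat n)"
  unfolding root_of_unity_def by (simp flip: exp_of_nat_mult add: mult_ac)

lemma norm_root_of_unity [simp]: "norm (root_of_unity n) = 1"
  unfolding root_of_unity_def by (simp add: norm_exp_eq_Re)

lemma root_of_unity_power_eq_iff:
  "0 < n \<Longrightarrow> root_of_unity n ^ a = root_of_unity n ^ b \<longleftrightarrow> a mod n = b mod n"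
  unfolding root_of_unity_power by (rule complex_root_unity_eq) simp

lemma root_of_unity_power_mod: "0 < n \<Longrightarrow> root_of_unity n ^ (a mod n) = root_of_unity n ^ a"
  by (simp add: root_of_unity_power_eq_iff)

text \<open>The factors \<open>q div p i\<close> in the codes turn powers of the \<open>q\<close>-th
  root into powers of the \<open>p i\<close>-th root, so each block can be treated modulo its own
  \<open>p i\<close>.\<close>

lemma root_of_unity_power_dvd:
  assumes "0 < n" "d dvd n"
  shows "root_of_unity n ^ (n div d * a) = root_of_unity d ^ a"
proof -
  obtain e where "n = d * e" using assms(2) by blast
  with assms(1) show ?thesis unfolding root_of_unity_power by (simp add: mult_ac)
qed

lemma mult_cnj_eq_1: "norm z = 1 \<Longrightarrow> z * cnj z = (1::complex)"
  by (simp add: complex_norm_square [symmetric])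

text \<open>A geometric sum whose ratio \<open>?z\<close> is an \<open>n\<close>-th root of unity,
  equal to 1 exactly when \<open>a\<close> and \<open>b\<close> are congruent.\<close>

lemma sum_root_of_unity:
  assumes "0 < n"
  shows "(\<Sum>v<n. root_of_unity n ^ (v * a) * cnj (root_of_unity n ^ (v * b)))
    = (if a mod n = b mod n then of_nat n else 0)"
proof -
  let ?w = "root_of_unity n"
  let ?z = "?w ^ a * cnj (?w ^ b)"
  have "?w ^ (v * a) * cnj (?w ^ (v * b)) = ?z ^ v" for v
    by (simp add: power_mult_distrib mult.commute flip: power_mult)
  then have sum: "(\<Sum>v<n. ?w ^ (v * a) * cnj (?w ^ (v * b))) = (\<Sum>v<n. ?z ^ v)" by simp
  have w1: "?w ^ j * cnj (?w ^ j) = 1" for j by (rule mult_cnj_eq_1) (simp add: norm_power)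
  have "?z = 1 \<longleftrightarrow> ?w ^ a = ?w ^ b"
  proof
    assume "?z = 1"
    then have "?w ^ a * (cnj (?w ^ b) * ?w ^ b) = ?w ^ b" by (metis mult.assoc mult_1)
    moreover have "cnj (?w ^ b) * ?w ^ b = 1" using w1[of b] by (metis mult.commute)
    ultimately show "?w ^ a = ?w ^ b" by (simp only: mult_1_right)
  qed (use w1 in simp)
  then have z1: "?z = 1 \<longleftrightarrow> a mod n = b mod n" by (simp add: root_of_unity_power_eq_iff[OF assms])
  have "?w ^ n = 1" using root_of_unity_power_eq_iff[OF assms, of n 0] by simp
  then have "?z ^ n = 1"
    by (simp add: power_mult_distrib flip: power_mult) (simp add: mult.commute[of _ n] power_mult flip: complex_cnj_power)
  then have "?z \<noteq> 1 \<Longrightarrow> (\<Sum>v<n. ?z ^ v) = 0" by (simp add: geometric_sum)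
  then show ?thesis using sum z1 by auto
qed

text \<open>Periodicity of \<open>G\<close> is required because values of \<open>\<phi>\<close> are
  not themselves reduced modulo \<open>n\<close>.\<close>

lemma permutes_mod_sum:
  fixes G :: "nat \<Rightarrow> 'a::comm_monoid_add"
  assumes "permutes_mod n \<phi>" "\<And>v. G (v mod n) = G v"
  shows "(\<Sum>u<n. G (\<phi> u)) = (\<Sum>v<n. G v)"
  using sum.reindex_bij_betw[OF assms(1)[unfolded permutes_mod_def], of G] by (simp only: assms(2))

lemma permutes_mod_inj:
  "permutes_mod n \<phi> \<Longrightarrow> a < n \<Longrightarrow> b < n \<Longrightarrow> \<phi> a mod n = \<phi> b mod n \<longleftrightarrow> a = b"
  unfolding permutes_mod_def bij_betw_def using inj_on_eq_iff[of "\<lambda>u. \<phi> u mod n" "{..<n}" a b] by simp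

lemma permutes_modI:
  assumes "0 < n" "\<And>a b. a < n \<Longrightarrow> b < n \<Longrightarrow> \<phi> a mod n = \<phi> b mod n \<Longrightarrow> a = b"
  shows "permutes_mod n \<phi>"
proof -
  have "inj_on (\<lambda>u. \<phi> u mod n) {..<n}" using assms(2) by (auto intro: inj_onI)
  moreover have "(\<lambda>u. \<phi> u mod n) ` {..<n} \<subseteq> {..<n}" using assms(1) by auto
  ultimately show ?thesis unfolding permutes_mod_def bij_betw_def by (simp add: endo_inj_surj)
qed

section \<open>Square matrices with orthogonal columns or rows\<close>

definition column_orth :: "nat \<Rightarrow> (nat \<Rightarrow> nat \<Rightarrow> complex) \<Rightarrow> bool" where
  "column_orth n M \<longleftrightarrow> (\<forall>a<n. \<forall>b<n. a \<noteq> b \<longrightarrow> (\<Sum>u<n. M u a * cnj (M u b)) = 0)"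

text \<open>Substituting \<open>v\<close> for \<open>\<phi> u\<close> makes the inner product of
  columns \<open>a\<close> and \<open>b\<close> a full character sum, which vanishes because
  \<open>\<phi>' a\<close> and \<open>\<phi>' b\<close> are incongruent.\<close>

lemma column_orth_exponential:
  assumes n: "0 < n" and phi: "permutes_mod n \<phi>" and chi: "permutes_mod n \<phi>'"
  shows "column_orth n (\<lambda>u v. root_of_unity n ^ (\<phi> u * \<phi>' v))"
  unfolding column_orth_def
proof safe
  fix a b assume "a < n" "b < n" "a \<noteq> b"
  let ?G = "\<lambda>v. root_of_unity n ^ (v * \<phi>' a) * cnj (root_of_unity n ^ (v * \<phi>' b))"
  have m: "root_of_unity n ^ (v mod n * c) = root_of_unity n ^ (v * c)" for v c
    by (simp add: root_of_unity_power_eq_iff[OF n] mod_mult_left_eq)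
  have "(\<Sum>u<n. ?G (\<phi> u)) = (\<Sum>v<n. ?G v)"
    by (rule permutes_mod_sum[OF phi]) (simp only: m)
  also have "\<dots> = 0" using \<open>a \<noteq> b\<close> permutes_mod_inj[OF chi \<open>a < n\<close> \<open>b < n\<close>] sum_root_of_unity[OF n] by simp
  finally show "(\<Sum>u<n. root_of_unity n ^ (\<phi> u * \<phi>' a) * cnj (root_of_unity n ^ (\<phi> u * \<phi>' b))) = 0" .
qed

text \<open>
  Counting, for a fixed residue \<open>r\<close>, the solutions of \<open>\<phi> u \<equiv> r\<close> by characters needs the exponential
  sums of \<open>\<phi>\<close> at all nonzero frequencies; these are supplied by the differences of the values of \<open>\<phi>'\<close>,
  so that no irreducibility of cyclotomic polynomials is required.
\<close>

lemma column_orth_exponential_iff: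
  assumes n: "0 < n"
  shows "column_orth n (\<lambda>u v. root_of_unity n ^ (\<phi> u * \<phi>' v)) \<longleftrightarrow> permutes_mod n \<phi> \<and> permutes_mod n \<phi>'"
    (is "?L \<longleftrightarrow> _")
proof (intro iffI conjI)
  let ?w = "root_of_unity n"
  have w1: "?w ^ j * cnj (?w ^ j) = 1" for j by (rule mult_cnj_eq_1) (simp add: norm_power)
  have wmod: "?w ^ (i * (j mod n)) = ?w ^ (i * j)" for i j
    by (simp add: root_of_unity_power_eq_iff[OF n] mod_mult_right_eq)
  assume L: ?L
  show chi: "permutes_mod n \<phi>'"
  proof (rule permutes_modI[OF n], rule ccontr)
    fix a b assume ab: "a < n" "b < n" "\<phi>' a mod n = \<phi>' b mod n" "a \<noteq> b"
    \<comment> \<open>Congruent values of \<open>\<phi>'\<close> give identical columns, whose inner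
      product is \<open>n\<close> and not 0.\<close>
    have "?w ^ (\<phi> u * \<phi>' a) = ?w ^ (\<phi> u * \<phi>' b)" for u
      using wmod[of "\<phi> u" "\<phi>' a"] wmod[of "\<phi> u" "\<phi>' b"] ab(3) by simp
    then have "(\<Sum>u<n. ?w ^ (\<phi> u * \<phi>' a) * cnj (?w ^ (\<phi> u * \<phi>' b))) = of_nat n" using w1 by simp
    then show False using L ab n unfolding column_orth_def by simp
  qed
  then have img: "(\<lambda>u. \<phi>' u mod n) ` {..<n} = {..<n}" unfolding permutes_mod_def bij_betw_def by simp
  have onto: "\<exists>a<n. \<phi>' a mod n = v" if "v < n" for v
  proof -
    have "v \<in> (\<lambda>u. \<phi>' u mod n) ` {..<n}" unfolding img using that by simp
    then show ?thesis by auto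
  qed
  have freq: "(\<Sum>u<n. ?w ^ (\<phi> u * d)) = 0" if d: "0 < d" "d < n" for d
  proof -
    obtain a where a: "a < n" "\<phi>' a mod n = d" using onto[OF d(2)] by (elim exE conjE)
    \<comment> \<open>The column with value 0 is constantly 1; its inner product with the column of
      value \<open>d\<close> is the bare exponential sum at frequency \<open>d\<close>.\<close>
    obtain b where b: "b < n" "\<phi>' b mod n = 0" using onto[OF n] by (elim exE conjE)
    have "\<phi>' a mod n \<noteq> \<phi>' b mod n" unfolding a(2) b(2) using d by simp
    then have "a \<noteq> b" by blast
    then have "(\<Sum>u<n. ?w ^ (\<phi> u * \<phi>' a) * cnj (?w ^ (\<phi> u * \<phi>' b))) = 0"
      using L[unfolded column_orth_def] a(1) b(1) by blast
    moreover have "?w ^ (\<phi> u * \<phi>' a) = ?w ^ (\<phi> u * d)" "?w ^ (\<phi> u * \<phi>' b) = 1" for u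
      using wmod[of "\<phi> u" "\<phi>' a"] wmod[of "\<phi> u" "\<phi>' b"] unfolding a(2) b(2) by simp_all
    ultimately show ?thesis by simp
  qed
  have count: "(\<Sum>u<n. if \<phi> u mod n = r then of_nat n else (0::complex)) = of_nat n" if "r < n" for r
  proof -
    have "(\<Sum>u<n. if \<phi> u mod n = r then of_nat n else (0::complex))
      = (\<Sum>u<n. \<Sum>d<n. ?w ^ (d * \<phi> u) * cnj (?w ^ (d * r)))"
      unfolding sum_root_of_unity[OF n] using that by simp
    also have "\<dots> = (\<Sum>d<n. \<Sum>u<n. ?w ^ (d * \<phi> u) * cnj (?w ^ (d * r)))" by (rule sum.swap)
    also have "\<dots> = (\<Sum>d<n. cnj (?w ^ (d * r)) * (\<Sum>u<n. ?w ^ (\<phi> u * d)))"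
      by (simp add: sum_distrib_left mult_ac)
    also have "\<dots> = (\<Sum>d<n. if d = 0 then of_nat n else 0)"
      by (rule sum.cong) (use freq in auto)
    finally show ?thesis using n by simp
  qed
  show "permutes_mod n \<phi>"
  proof (rule permutes_modI[OF n], rule ccontr)
    fix a b assume ab: "a < n" "b < n" "\<phi> a mod n = \<phi> b mod n" "a \<noteq> b"
    let ?r = "\<phi> a mod n"
    have "of_nat n = (\<Sum>u | u < n \<and> \<phi> u mod n = ?r. of_nat n :: complex)"
      using count[of ?r] n by (simp add: sum.If_cases Int_def)
    also have "\<dots> = of_nat (card {u. u < n \<and> \<phi> u mod n = ?r} * n)" by simp
    finally have "card {u. u < n \<and> \<phi> u mod n = ?r} * n = n" unfolding of_nat_eq_iff by (rule sym)
    then have "card {u. u < n \<and> \<phi> u mod n = ?r} = 1" using n by simp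
    moreover have "{a, b} \<subseteq> {u. u < n \<and> \<phi> u mod n = ?r}" using ab by auto
    ultimately show False using card_mono[of "{u. u < n \<and> \<phi> u mod n = ?r}" "{a,b}"] ab(4) by simp
  qed
next
  assume "permutes_mod n \<phi> \<and> permutes_mod n \<phi>'"
  then show ?L using column_orth_exponential[OF n] by blast
qed

definition row_orth :: "nat \<Rightarrow> (nat \<Rightarrow> nat \<Rightarrow> complex) \<Rightarrow> bool" where
  "row_orth n M \<longleftrightarrow> column_orth n (\<lambda>u v. M v u)"

text \<open>The functions \<open>gij\<close> enter an edge matrix only as unimodular factors of its
  columns. Such factors multiply each inner product of columns by a nonzero number; in inner
  products of rows they cancel against their conjugates.\<close>

lemma column_orth_weighted:
  assumes "\<And>v. norm (\<gamma> v) = 1"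
  shows "column_orth n (\<lambda>u v. M u v * \<gamma> v) \<longleftrightarrow> column_orth n M"
proof -
  have *: "(\<Sum>u<n. M u a * \<gamma> a * cnj (M u b * \<gamma> b))
    = \<gamma> a * cnj (\<gamma> b) * (\<Sum>u<n. M u a * cnj (M u b))" for a b
    by (simp add: sum_distrib_left mult_ac)
  have "\<gamma> a \<noteq> 0" for a using assms[of a] by auto
  then show ?thesis unfolding column_orth_def * by simp
qed

lemma row_orth_weighted:
  assumes "\<And>v. norm (\<gamma> v) = 1"
  shows "row_orth n (\<lambda>u v. M u v * \<gamma> v) \<longleftrightarrow> row_orth n M"
proof -
  have "M a u * \<gamma> u * cnj (M b u * \<gamma> u) = M a u * cnj (M b u)" for a b u
    using mult_cnj_eq_1[OF assms[of u]] by (simp add: algebra_simps)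
  then show ?thesis unfolding column_orth_def row_orth_def by (simp only:)
qed

text \<open>Transposing the matrix exchanges \<open>\<phi>\<close> and \<open>\<phi>'\<close>, and
  the criterion for columns is symmetric in them.\<close>

lemma row_orth_exponential:
  assumes "0 < n" "permutes_mod n \<phi>" "permutes_mod n \<phi>'"
  shows "row_orth n (\<lambda>u v. root_of_unity n ^ (\<phi> u * \<phi>' v))"
  using column_orth_exponential[OF assms(1,3,2)] unfolding row_orth_def by (simp add: mult.commute)

subsection \<open>Characters of the label group\<close>

definition character :: "nat \<Rightarrow> (nat \<Rightarrow> nat) \<Rightarrow> (nat \<Rightarrow> nat) \<Rightarrow> (nat \<Rightarrow> nat \<Rightarrow> nat) \<Rightarrow> (nat \<Rightarrow> nat \<Rightarrow> nat) \<Rightarrow> complex" where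
  "character k p e d v = (\<Prod>i=1..k. \<Prod>j=1..e i. root_of_unity (p i) ^ (d i j * v i j))"

lemma character_commute: "character k p e d v = character k p e v d"
  unfolding character_def by (simp add: mult.commute)

lemma finite_block_vecs [simp]: "finite (block_vecs k p e)"
  unfolding block_vecs_def by (intro finite_PiE) auto

lemma block_vecs_less: "v \<in> block_vecs k p e \<Longrightarrow> i \<in> {1..k} \<Longrightarrow> j \<in> {1..e i} \<Longrightarrow> v i j < p i"
  unfolding block_vecs_def by (auto dest!: PiE_mem)

lemma card_block_vecs: "card (block_vecs k p e) = (\<Prod>i=1..k. p i ^ e i)"
  unfolding block_vecs_def by (simp add: card_PiE)

lemma block_vecs_eqI:
  assumes "v \<in> block_vecs k p e" "w \<in> block_vecs k p e"
    and "\<And>i j. i \<in> {1..k} \<Longrightarrow> j \<in> {1..e i} \<Longrightarrow> v i j = w i j"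
  shows "v = w"
proof (rule PiE_ext[OF assms(1,2)[unfolded block_vecs_def]])
  fix i assume i: "i \<in> {1..k}"
  have "v i \<in> (\<Pi>\<^sub>E j\<in>{1..e i}. {..<p i})" "w i \<in> (\<Pi>\<^sub>E j\<in>{1..e i}. {..<p i})"
    using assms(1,2) i unfolding block_vecs_def by (auto dest: PiE_mem)
  then show "v i = w i" by (rule PiE_ext) (use assms(3) i in auto)
qed

text \<open>The sum factors into one geometric sum per entry; the bounds on the entries turn
  congruence modulo \<open>p i\<close> into equality.\<close>

lemma sum_character:
  assumes p: "\<And>i. i \<in> {1..k} \<Longrightarrow> 0 < p i"
    and v: "\<And>i j. i \<in> {1..k} \<Longrightarrow> j \<in> {1..e i} \<Longrightarrow> v i j < p i \<and> w i j < p i"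
  shows "(\<Sum>d\<in>block_vecs k p e. character k p e d v * cnj (character k p e d w))
    = (if \<forall>i\<in>{1..k}. \<forall>j\<in>{1..e i}. v i j = w i j then of_nat (\<Prod>i=1..k. p i ^ e i) else 0)"
proof -
  let ?h = "\<lambda>i j a. root_of_unity (p i) ^ (a * v i j) * cnj (root_of_unity (p i) ^ (a * w i j))"
  have "(\<Sum>d\<in>block_vecs k p e. character k p e d v * cnj (character k p e d w))
    = (\<Sum>d\<in>block_vecs k p e. \<Prod>i=1..k. \<Prod>j=1..e i. ?h i j (d i j))"
    unfolding character_def by (simp add: prod.distrib)
  also have "\<dots> = (\<Prod>i=1..k. \<Sum>g\<in>(\<Pi>\<^sub>E j\<in>{1..e i}. {..<p i}). \<Prod>j=1..e i. ?h i j (g j))"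
    unfolding block_vecs_def by (rule prod_sum_PiE[symmetric]) (auto intro: finite_PiE)
  also have "\<dots> = (\<Prod>i=1..k. \<Prod>j=1..e i. \<Sum>a<p i. ?h i j a)"
    by (intro prod.cong refl prod_sum_PiE[symmetric]) auto
  also have "\<dots> = (\<Prod>i=1..k. \<Prod>j=1..e i. if v i j = w i j then of_nat (p i) else 0)"
  proof (intro prod.cong refl)
    fix i j assume ij: "i \<in> {1..k}" "j \<in> {1..e i}"
    show "(\<Sum>a<p i. ?h i j a) = (if v i j = w i j then of_nat (p i) else 0)"
      using sum_root_of_unity[OF p[OF ij(1)], of "v i j" "w i j"] v[OF ij] by simp
  qed
  also have "\<dots> = (if \<forall>i\<in>{1..k}. \<forall>j\<in>{1..e i}. v i j = w i j then of_nat (\<Prod>i=1..k. p i ^ e i) else 0)"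
  proof (cases "\<forall>i\<in>{1..k}. \<forall>j\<in>{1..e i}. v i j = w i j")
    case True then show ?thesis by simp
  next
    case False
    then obtain i j where ij: "i \<in> {1..k}" "j \<in> {1..e i}" "v i j \<noteq> w i j" by blast
    then have "(\<Prod>j=1..e i. if v i j = w i j then of_nat (p i) else (0::complex)) = 0"
      by (intro prod_zero bexI[of _ j]) auto
    then have "(\<Prod>i=1..k. \<Prod>j=1..e i. if v i j = w i j then of_nat (p i) else (0::complex)) = 0"
      using ij(1) by (intro prod_zero finite_atLeastAtMost; intro bexI[of _ i])
    with False show ?thesis by auto
  qed
  finally show ?thesis .
qed

text \<open>The left side is a Fourier transform, in two label variables, of the function sending
  \<open>(a, b)\<close> to the sum of \<open>w\<close> over the level set of
  \<open>(\<eta>, \<theta>)\<close>. The transform is injective, so one vanishes identically iff the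
  other does.\<close>

lemma Fourier_vanishing_iff:
  fixes w :: "'a \<Rightarrow> complex"
  assumes p: "\<And>i. i \<in> {1..k} \<Longrightarrow> 0 < p i" and A: "finite A"
    and eta: "\<And>z. z \<in> A \<Longrightarrow> \<eta> z \<in> block_vecs k p e" and theta: "\<And>z. z \<in> A \<Longrightarrow> \<theta> z \<in> block_vecs k p e"
  shows "(\<forall>t\<in>block_vecs k p e. \<forall>t'\<in>block_vecs k p e.
      (\<Sum>z\<in>A. w z * (character k p e t (\<eta> z) * cnj (character k p e t' (\<theta> z)))) = 0) \<longleftrightarrow>
    (\<forall>a\<in>block_vecs k p e. \<forall>b\<in>block_vecs k p e. (\<Sum>z | z \<in> A \<and> \<eta> z = a \<and> \<theta> z = b. w z) = 0)"
    (is "?L \<longleftrightarrow> ?R")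
proof
  let ?B = "block_vecs k p e" and ?c = "character k p e"
  assume R: ?R
  show ?L
  proof (intro ballI)
    fix t t' assume "t \<in> ?B" "t' \<in> ?B"
    let ?F = "\<lambda>z. w z * (?c t (\<eta> z) * cnj (?c t' (\<theta> z)))"
    have "(\<Sum>z\<in>A. ?F z) = (\<Sum>ab\<in>?B \<times> ?B. \<Sum>z | z \<in> A \<and> (\<eta> z, \<theta> z) = ab. ?F z)"
      by (rule sum.group[symmetric]) (use A eta theta in auto)
    also have "\<dots> = (\<Sum>ab\<in>?B \<times> ?B. (\<Sum>z | z \<in> A \<and> (\<eta> z, \<theta> z) = ab. w z) * (?c t (fst ab) * cnj (?c t' (snd ab))))"
      unfolding sum_distrib_right by (intro sum.cong refl) auto
    also have "\<dots> = 0" by (rule sum.neutral) (use R in auto)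
    finally show "(\<Sum>z\<in>A. ?F z) = 0" .
  qed
next
  let ?B = "block_vecs k p e" and ?c = "character k p e"
  assume L: ?L
  show ?R
  proof (intro ballI)
    fix a b assume ab: "a \<in> ?B" "b \<in> ?B"
    define K where "K = (\<Prod>i=1..k. p i ^ e i)"
    have K: "0 < K" unfolding K_def using p by (intro prod_pos) auto
    have orth: "(\<Sum>t\<in>?B. ?c t u * cnj (?c t v)) = (if u = v then of_nat K else 0)"
      if "u \<in> ?B" "v \<in> ?B" for u v
    proof -
      have "(\<forall>i\<in>{1..k}. \<forall>j\<in>{1..e i}. u i j = v i j) \<longleftrightarrow> u = v"
        using block_vecs_eqI[OF that] by blast
      moreover have "(\<Sum>t\<in>?B. ?c t u * cnj (?c t v))
        = (if \<forall>i\<in>{1..k}. \<forall>j\<in>{1..e i}. u i j = v i j then of_nat K else 0)"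
        unfolding K_def by (rule sum_character) (use p that block_vecs_less in auto)
      ultimately show ?thesis by simp
    qed
    \<comment> \<open>Inverse transform at \<open>(a, b)\<close>: orthogonality in \<open>t\<close>
      and in \<open>t'\<close> leaves the level set, with the nonzero factor
      \<open>K * K\<close>.\<close>
    have "0 = (\<Sum>t\<in>?B. \<Sum>t'\<in>?B. (cnj (?c t a) * ?c t' b) * (\<Sum>z\<in>A. w z * (?c t (\<eta> z) * cnj (?c t' (\<theta> z)))))"
      using L by simp
    also have "\<dots> = (\<Sum>t\<in>?B. \<Sum>t'\<in>?B. \<Sum>z\<in>A. w z * ((?c t (\<eta> z) * cnj (?c t a)) * cnj (?c t' (\<theta> z) * cnj (?c t' b))))"
      by (simp add: sum_distrib_left mult_ac)
    also have "\<dots> = (\<Sum>t\<in>?B. \<Sum>z\<in>A. \<Sum>t'\<in>?B. w z * ((?c t (\<eta> z) * cnj (?c t a)) * cnj (?c t' (\<theta> z) * cnj (?c t' b))))"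
      by (intro sum.cong refl sum.swap)
    also have "\<dots> = (\<Sum>z\<in>A. \<Sum>t\<in>?B. \<Sum>t'\<in>?B. w z * ((?c t (\<eta> z) * cnj (?c t a)) * cnj (?c t' (\<theta> z) * cnj (?c t' b))))"
      by (rule sum.swap)
    also have "\<dots> = (\<Sum>z\<in>A. w z * ((\<Sum>t\<in>?B. ?c t (\<eta> z) * cnj (?c t a)) * cnj (\<Sum>t'\<in>?B. ?c t' (\<theta> z) * cnj (?c t' b))))"
      unfolding cnj_sum sum_product by (simp only: sum_distrib_left)
    also have "\<dots> = (\<Sum>z\<in>A. if \<eta> z = a \<and> \<theta> z = b then w z * of_nat (K * K) else 0)"
      by (rule sum.cong) (use orth ab eta theta in auto)
    also have "\<dots> = (\<Sum>z | z \<in> A \<and> \<eta> z = a \<and> \<theta> z = b. w z) * of_nat (K * K)"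
      by (simp add: sum.If_cases A Int_def sum_distrib_right)
    finally show "(\<Sum>z | z \<in> A \<and> \<eta> z = a \<and> \<theta> z = b. w z) = 0" using K by simp
  qed
qed

subsection \<open>Mixed-radix labels\<close>

lemma mixed_radix_Suc:
  fixes Q v :: "nat \<Rightarrow> nat"
  shows "(\<Sum>i=1..Suc k. v i * (\<Prod>\<alpha>=1..<i. Q \<alpha>))
    = (\<Sum>i=1..k. v i * (\<Prod>\<alpha>=1..<i. Q \<alpha>)) + v (Suc k) * (\<Prod>i=1..k. Q i)"
  by (subst sum.cl_ivl_Suc) (simp only: atLeastLessThanSuc_atLeastAtMost, simp)

lemma mixed_radix_less:
  fixes Q v :: "nat \<Rightarrow> nat"
  assumes "\<And>i. i \<in> {1..k} \<Longrightarrow> v i < Q i"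
  shows "(\<Sum>i=1..k. v i * (\<Prod>\<alpha>=1..<i. Q \<alpha>)) < (\<Prod>i=1..k. Q i)"
  using assms
proof (induction k)
  case (Suc k)
  let ?P = "\<Prod>i=1..k. Q i"
  have "(\<Sum>i=1..k. v i * (\<Prod>\<alpha>=1..<i. Q \<alpha>)) < ?P" using Suc by simp
  moreover have "(v (Suc k) + 1) * ?P \<le> Q (Suc k) * ?P" using Suc.prems[of "Suc k"] by (intro mult_right_mono) auto
  ultimately show ?case unfolding mixed_radix_Suc by (simp add: algebra_simps)
qed simp

text \<open>The top digit is the quotient by the product of the lower radices, since the lower part
  is smaller than that product; the remainder is handled by induction.\<close>

lemma mixed_radix_inj:
  fixes Q v w :: "nat \<Rightarrow> nat"
  assumes "\<And>i. i \<in> {1..k} \<Longrightarrow> v i < Q i" "\<And>i. i \<in> {1..k} \<Longrightarrow> w i < Q i"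
    and "(\<Sum>i=1..k. v i * (\<Prod>\<alpha>=1..<i. Q \<alpha>)) = (\<Sum>i=1..k. w i * (\<Prod>\<alpha>=1..<i. Q \<alpha>))"
    and "i \<in> {1..k}"
  shows "v i = w i"
  using assms
proof (induction k arbitrary: i)
  case (Suc k)
  let ?P = "\<Prod>i=1..k. Q i" and ?s = "\<lambda>v. \<Sum>i=1..k. v i * (\<Prod>\<alpha>=1..<i. Q \<alpha>)"
  have less: "?s v < ?P" "?s w < ?P" by (intro mixed_radix_less; use Suc.prems in auto)+
  have sums: "?s v + v (Suc k) * ?P = ?s w + w (Suc k) * ?P" using Suc.prems(3) unfolding mixed_radix_Suc .
  have "?P \<noteq> 0" using less by linarith
  then have "v (Suc k) = w (Suc k)"
    using arg_cong[OF sums, of "\<lambda>x. x div ?P"] less by simp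
  moreover have "?s v = ?s w" using sums calculation by simp
  ultimately show ?case using Suc.IH[of i] Suc.prems by (cases "i = Suc k") auto
qed simp

text \<open>Two nested mixed-radix expansions: constant radix \<open>p i\<close> inside a block,
  radix \<open>p i ^ e i\<close> across blocks. Both are injective, and surjectivity follows by
  counting.\<close>

lemma label_bij_betw:
  assumes p: "\<And>i. i \<in> {1..k} \<Longrightarrow> 0 < p i"
  shows "bij_betw (label k p e) (block_vecs k p e) {..<\<Prod>i=1..k. p i ^ e i}"
proof -
  let ?d = "\<lambda>v i. \<Sum>j=1..e i. v i j * p i ^ (j - 1)"
  have pw: "(\<Prod>\<alpha>=1..<j. p i) = p i ^ (j - 1)" for i j by simp
  have less: "?d v i < p i ^ e i" if "v \<in> block_vecs k p e" "i \<in> {1..k}" for v i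
    using mixed_radix_less[of "e i" "v i" "\<lambda>_. p i"] block_vecs_less[OF that] by simp
  have inj: "inj_on (label k p e) (block_vecs k p e)"
  proof (rule inj_onI)
    fix v w assume vw: "v \<in> block_vecs k p e" "w \<in> block_vecs k p e" "label k p e v = label k p e w"
    show "v = w"
    proof (rule block_vecs_eqI[OF vw(1,2)])
      fix i j assume ij: "i \<in> {1..k}" "j \<in> {1..e i}"
      have "?d v i = ?d w i"
        by (rule mixed_radix_inj[where v="?d v" and w="?d w" and Q="\<lambda>i. p i ^ e i" and k=k])
          (use less vw ij in \<open>auto simp: label_def\<close>)
      then show "v i j = w i j"
        by (intro mixed_radix_inj[where v="v i" and w="w i" and Q="\<lambda>_. p i" and k="e i"])
          (use block_vecs_less vw ij in auto)
    qed
  qed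
  moreover have sub: "label k p e ` block_vecs k p e \<subseteq> {..<\<Prod>i=1..k. p i ^ e i}"
    unfolding label_def using mixed_radix_less[where Q="\<lambda>i. p i ^ e i" and k=k] less by auto
  have "label k p e ` block_vecs k p e = {..<\<Prod>i=1..k. p i ^ e i}"
    by (rule card_subset_eq[OF _ sub]) (simp_all add: card_image[OF inj] card_block_vecs)
  with inj show ?thesis unfolding bij_betw_def by blast
qed

subsection \<open>Constrained correlations of a product weight\<close>

definition assigns :: "'v set \<Rightarrow> ('v \<Rightarrow> nat) \<Rightarrow> ('v \<Rightarrow> nat) set" where
  "assigns S P = (\<Pi>\<^sub>E s\<in>S. {..<P s})"

definition shift :: "'v set \<Rightarrow> ('v \<Rightarrow> int) \<Rightarrow> ('v \<Rightarrow> nat) \<Rightarrow> ('v \<Rightarrow> nat) \<Rightarrow> int" where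
  "shift S W x y = (\<Sum>s\<in>S. (int (y s) - int (x s)) * W s)"

definition agree :: "'v set \<Rightarrow> ('v \<Rightarrow> nat) \<Rightarrow> ('v \<Rightarrow> nat) \<Rightarrow> bool" where
  "agree E x y \<longleftrightarrow> (\<forall>s\<in>E. x s = y s)"

text \<open>Uniqueness of mixed-radix expansions in a form that is inherited by subsets of the
  variables.\<close>

definition dissociated :: "'v set \<Rightarrow> ('v \<Rightarrow> nat) \<Rightarrow> ('v \<Rightarrow> int) \<Rightarrow> bool" where
  "dissociated S P W \<longleftrightarrow> (\<forall>x\<in>assigns S P. \<forall>y\<in>assigns S P. shift S W x y = 0 \<longrightarrow> x = y)"

text \<open>\<open>F\<close> collects the positions where the two assignments must coincide,
  \<open>E\<close> those where they are prescribed by \<open>\<alpha>\<close> and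
  \<open>\<beta>\<close>. Both prescriptions are arbitrary functions; values out of range leave an
  empty sum.\<close>

definition pair_corr where
  "pair_corr S P W F E w \<tau> \<alpha> \<beta> =
    (\<Sum>x\<in>assigns S P. \<Sum>y\<in>assigns S P.
      if agree F x y \<and> agree E x \<alpha> \<and> agree E y \<beta> \<and> shift S W x y = \<tau> then w x * cnj (w y) else (0::complex))"

definition vanishing where
  "vanishing S P W F E w \<longleftrightarrow> (\<forall>\<tau> \<alpha> \<beta>. \<tau> \<noteq> 0 \<longrightarrow> pair_corr S P W F E w \<tau> \<alpha> \<beta> = 0)"

lemma finite_assigns [simp]: "finite S \<Longrightarrow> finite (assigns S P)"
  unfolding assigns_def by (intro finite_PiE) auto

lemma assigns_less: "x \<in> assigns S P \<Longrightarrow> s \<in> S \<Longrightarrow> x s < P s"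
  unfolding assigns_def by (auto dest!: PiE_mem)

lemma sum_assigns_insert:
  assumes "finite S" "s \<notin> S"
  shows "(\<Sum>x\<in>assigns (insert s S) P. h x) = (\<Sum>a<P s. \<Sum>x\<in>assigns S P. h (x(s := a)))"
proof -
  have "(\<Sum>x\<in>assigns (insert s S) P. h x) = (\<Sum>z\<in>{..<P s} \<times> assigns S P. h ((\<lambda>(a, x). x(s := a)) z))"
    unfolding assigns_def PiE_insert_eq by (rule sum.reindex[OF inj_combinator[OF assms(2)], unfolded comp_def])
  also have "\<dots> = (\<Sum>a<P s. \<Sum>x\<in>assigns S P. h (x(s := a)))"
    unfolding sum.cartesian_product by (rule sum.cong) auto
  finally show ?thesis .
qed

lemma agree_insert: "agree (insert s E) x y \<longleftrightarrow> x s = y s \<and> agree E x y"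
  unfolding agree_def by auto

lemma agree_upd [simp]: "s \<notin> E \<Longrightarrow> agree E (x(s := a)) y = agree E x y" "s \<notin> E \<Longrightarrow> agree E x (y(s := a)) = agree E x y"
  unfolding agree_def by auto

lemma shift_insert_upd:
  assumes "finite S" "s \<notin> S"
  shows "shift (insert s S) W (x(s := a)) (y(s := b)) = shift S W x y + (int b - int a) * W s"
proof -
  have "shift S W (x(s := a)) (y(s := b)) = shift S W x y"
    unfolding shift_def by (rule sum.cong) (use assms in auto)
  then show ?thesis using assms by (simp add: shift_def)
qed

text \<open>Assignments on the smaller set are extended by 0, an admissible value since
  \<open>P\<close> is positive, and this does not change the shift.\<close>

lemma dissociated_subset:
  assumes "dissociated S P W" "T \<subseteq> S" "finite S" "\<And>s. s \<in> S \<Longrightarrow> 0 < P s"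
  shows "dissociated T P W"
  unfolding dissociated_def
proof (intro ballI impI)
  fix x y assume xy: "x \<in> assigns T P" "y \<in> assigns T P" "shift T W x y = 0"
  define ext where "ext z = (\<lambda>s\<in>S. if s \<in> T then z s else 0)" for z :: "'a \<Rightarrow> nat"
  have mem: "ext z \<in> assigns S P" if "z \<in> assigns T P" for z
    using assigns_less[OF that] assms(4) unfolding ext_def assigns_def by auto
  have "shift S W (ext x) (ext y) = shift T W (ext x) (ext y)"
    unfolding shift_def by (rule sum.mono_neutral_right) (use assms(2,3) in \<open>auto simp: ext_def\<close>)
  also have "\<dots> = shift T W x y"
    unfolding shift_def by (rule sum.cong) (use assms(2) in \<open>auto simp: ext_def\<close>)
  finally have e: "ext x = ext y" using assms(1) mem xy unfolding dissociated_def by simp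
  show "x = y"
  proof (rule PiE_ext[OF xy(1,2)[unfolded assigns_def]])
    fix s assume "s \<in> T" then show "x s = y s" using fun_cong[OF e, of s] assms(2) by (auto simp: ext_def)
  qed
qed

lemma card_agree:
  assumes "finite S" "E \<subseteq> S" "\<And>s. s \<in> E \<Longrightarrow> \<alpha> s < P s"
  shows "card {x \<in> assigns S P. agree E x \<alpha>} = (\<Prod>s\<in>S - E. P s)"
proof -
  have "{x \<in> assigns S P. agree E x \<alpha>} = (\<Pi>\<^sub>E s\<in>S. if s \<in> E then {\<alpha> s} else {..<P s})"
  proof (intro set_eqI iffI)
    fix x assume x: "x \<in> (\<Pi>\<^sub>E s\<in>S. if s \<in> E then {\<alpha> s} else {..<P s})"
    have "x s = \<alpha> s" if "s \<in> E" for s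
      using PiE_mem[OF x, of s] that assms(2) by auto
    moreover have "x s < P s" if "s \<in> S" for s
      using PiE_mem[OF x that] assms(3)[of s] by (cases "s \<in> E") simp_all
    ultimately show "x \<in> {x \<in> assigns S P. agree E x \<alpha>}"
      using x unfolding assigns_def agree_def PiE_iff by simp
  qed (auto simp: assigns_def agree_def PiE_iff)
  also have "card \<dots> = (\<Prod>s\<in>S. if s \<in> E then 1 else P s)"
    by (subst card_PiE[OF assms(1)], intro prod.cong) auto
  also have "\<dots> = (\<Prod>s\<in>S - E. P s)"
    using assms(1) by (simp add: prod.If_cases Diff_eq)
  finally show ?thesis .
qed

text \<open>Dissociation leaves only pairs with \<open>x = y\<close>. Each contributes 1, and the
  value counts the assignments with the prescribed entries.\<close>

lemma pair_corr_0:
  assumes fin: "finite S" and E: "E \<subseteq> S" and dis: "dissociated S P W"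
    and w: "\<And>x. x \<in> assigns S P \<Longrightarrow> norm (w x) = 1" and \<alpha>: "\<And>s. s \<in> E \<Longrightarrow> \<alpha> s < P s"
  shows "pair_corr S P W F E w 0 \<alpha> \<beta> = (if agree E \<alpha> \<beta> then of_nat (\<Prod>s\<in>S - E. P s) else 0)"
proof -
  have "shift S W x y = 0 \<longleftrightarrow> x = y" if "x \<in> assigns S P" "y \<in> assigns S P" for x y
    using dis that unfolding dissociated_def by (auto simp: shift_def)
  then have "pair_corr S P W F E w 0 \<alpha> \<beta> = (\<Sum>x\<in>assigns S P. \<Sum>y\<in>assigns S P.
      if x = y then if agree E x \<alpha> \<and> agree E x \<beta> then w x * cnj (w x) else 0 else 0)"
    unfolding pair_corr_def by (intro sum.cong refl) (auto simp: agree_def)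
  also have "\<dots> = (\<Sum>x\<in>assigns S P. if agree E x \<alpha> \<and> agree E \<alpha> \<beta> then 1 else 0)"
    using fin by (intro sum.cong refl) (auto simp: agree_def mult_cnj_eq_1 w)
  also have "\<dots> = (if agree E \<alpha> \<beta> then of_nat (card {x \<in> assigns S P. agree E x \<alpha>}) else 0)"
    using fin by (simp add: sum.If_cases Int_def)
  finally show ?thesis using card_agree[OF fin E \<alpha>] by simp
qed

text \<open>A variable at the start of a block is subject to \<open>x s = y s\<close> and only contributes a phase.\<close>

lemma vanishing_insert_first:
  assumes fin: "finite S" and s: "s \<notin> S" and F: "F \<subseteq> S" and E: "E \<subseteq> S" and P: "0 < P s"
    and w': "\<And>x a. x \<in> assigns S P \<Longrightarrow> w' (x(s := a)) = w x * \<nu> x a"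
    and \<nu>: "\<And>x a. norm (\<nu> x a) = 1" "\<And>x y a. agree E x y \<Longrightarrow> \<nu> x a = \<nu> y a"
  shows "vanishing (insert s S) P W (insert s F) (insert s E) w' \<longleftrightarrow> vanishing S P W F E w"
proof -
  have sFE: "s \<notin> F" "s \<notin> E" using s F E by auto
  \<comment> \<open>Equality of the two values at \<open>s\<close> cancels its contribution to the
    shift, so \<open>\<tau>\<close> stays the same. The phase depends on \<open>x\<close> only
    through the prescribed entries and can be taken at \<open>\<alpha>\<close> and
    \<open>\<beta>\<close>.\<close>
  have eq: "pair_corr (insert s S) P W (insert s F) (insert s E) w' \<tau> \<alpha> \<beta> =
    (if \<alpha> s < P s \<and> \<alpha> s = \<beta> s then \<nu> \<alpha> (\<alpha> s) * cnj (\<nu> \<beta> (\<alpha> s)) * pair_corr S P W F E w \<tau> \<alpha> \<beta> else 0)"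
    (is "?lhs = ?rhs") for \<tau> \<alpha> \<beta>
  proof -
    let ?c = "\<lambda>x y. agree F x y \<and> agree E x \<alpha> \<and> agree E y \<beta> \<and> shift S W x y = \<tau>"
    have "?lhs = (\<Sum>a<P s. \<Sum>x\<in>assigns S P. \<Sum>b<P s. \<Sum>y\<in>assigns S P.
        if b = \<beta> s then if a = \<alpha> s then if a = b \<and> ?c x y then (w x * \<nu> \<alpha> a) * cnj (w y * \<nu> \<beta> b) else 0 else 0 else 0)"
      unfolding pair_corr_def sum_assigns_insert[OF fin s]
      by (intro sum.cong refl) (auto simp: agree_insert sFE shift_insert_upd[OF fin s] w' \<nu>(2)[of _ \<alpha>] \<nu>(2)[of _ \<beta>])
    also have "\<dots> = (\<Sum>a<P s. \<Sum>x\<in>assigns S P. \<Sum>b<P s. if b = \<beta> s then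
        \<Sum>y\<in>assigns S P. if a = \<alpha> s then if a = b \<and> ?c x y then (w x * \<nu> \<alpha> a) * cnj (w y * \<nu> \<beta> b) else 0 else 0 else 0)"
      by (intro sum.cong refl) simp
    also have "\<dots> = (\<Sum>a<P s. if a = \<alpha> s then if \<beta> s < P s then
       \<Sum>x\<in>assigns S P. \<Sum>y\<in>assigns S P. if a = \<beta> s \<and> ?c x y then (w x * \<nu> \<alpha> a) * cnj (w y * \<nu> \<beta> (\<beta> s)) else 0 else 0 else 0)"
      by (intro sum.cong refl) simp
    also have "\<dots> = (if \<alpha> s < P s \<and> \<beta> s < P s then
       \<Sum>x\<in>assigns S P. \<Sum>y\<in>assigns S P. if \<alpha> s = \<beta> s \<and> ?c x y then (w x * \<nu> \<alpha> (\<alpha> s)) * cnj (w y * \<nu> \<beta> (\<beta> s)) else 0 else 0)"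
      by simp
    also have "\<dots> = ?rhs"
    proof (cases "\<alpha> s < P s \<and> \<alpha> s = \<beta> s")
      case True
      then show ?thesis unfolding pair_corr_def sum_distrib_left
        by (auto intro!: sum.cong)
    next
      case False
      then show ?thesis by auto
    qed
    finally show ?thesis .
  qed
  show ?thesis
  proof
    assume "vanishing S P W F E w"
    then show "vanishing (insert s S) P W (insert s F) (insert s E) w'"
      unfolding vanishing_def eq by simp
  next
    assume V: "vanishing (insert s S) P W (insert s F) (insert s E) w'"
    show "vanishing S P W F E w" unfolding vanishing_def
    proof (intro allI impI)
      fix \<tau> :: int and \<alpha> \<beta> :: "'a \<Rightarrow> nat" assume "\<tau> \<noteq> 0"
      \<comment> \<open>The correlations on \<open>S\<close> do not see position \<open>s\<close>;
        setting both prescriptions to 0 there puts them into the nontrivial case of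
        \<open>eq\<close>.\<close>
      let ?\<alpha> = "\<alpha>(s := 0)" and ?\<beta> = "\<beta>(s := 0)"
      have "pair_corr (insert s S) P W (insert s F) (insert s E) w' \<tau> ?\<alpha> ?\<beta> = 0"
        using V \<open>\<tau> \<noteq> 0\<close> unfolding vanishing_def by blast
      then have "\<nu> ?\<alpha> 0 * cnj (\<nu> ?\<beta> 0) * pair_corr S P W F E w \<tau> ?\<alpha> ?\<beta> = 0"
        using P unfolding eq by simp
      moreover have "\<nu> x 0 \<noteq> 0" for x using \<nu>(1)[of x 0] by auto
      ultimately have "pair_corr S P W F E w \<tau> ?\<alpha> ?\<beta> = 0" by simp
      then show "pair_corr S P W F E w \<tau> \<alpha> \<beta> = 0" unfolding pair_corr_def by (simp add: sFE)
    qed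
  qed
qed

text \<open>Freeing position \<open>l\<close> amounts to summing over all values \<open>u\<close>
  prescribed there. This turns the factor \<open>M (x l) a\<close> of an edge into the constant
  \<open>M u a\<close>.\<close>

lemma sum_agree_upd:
  assumes "l \<in> E" "l \<in> S" "finite S" "x \<in> assigns S P"
  shows "(if agree (E - {l}) x \<alpha> then h (x l) else 0) = (\<Sum>u<P l. if agree E x (\<alpha>(l := u)) then h u else (0::complex))"
proof -
  have "agree E x (\<alpha>(l := u)) \<longleftrightarrow> u = x l \<and> agree (E - {l}) x \<alpha>" for u
    unfolding agree_def using assms(1) by auto
  then have "(\<Sum>u<P l. if agree E x (\<alpha>(l := u)) then h u else (0::complex))
    = (\<Sum>u<P l. if u = x l then if agree (E - {l}) x \<alpha> then h u else 0 else 0)"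
    by (intro sum.cong) auto
  then show ?thesis using assigns_less[OF assms(4,2)] by simp
qed

text \<open>
  An edge acts as a transfer matrix \<open>M\<close> on the index \<open>l\<close>, combined with a translation of the
  shift; a column-orthogonal \<open>M\<close> preserves the vanishing of the correlations, and is forced
  by the correlations whose remaining variables coincide.
\<close>

lemma vanishing_insert_edge:
  assumes fin: "finite S" and s: "s \<notin> S" and F: "F \<subseteq> S" and E: "E \<subseteq> S" and l: "l \<in> E"
    and P: "P s = P l" "\<And>r. r \<in> insert s S \<Longrightarrow> 0 < P r"
    and w': "\<And>x a. x \<in> assigns S P \<Longrightarrow> w' (x(s := a)) = w x * M (x l) a"
    and w: "\<And>x. x \<in> assigns S P \<Longrightarrow> norm (w x) = 1" and M: "\<And>u a. norm (M u a) = 1"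
    and dis: "dissociated (insert s S) P W"
    and row: "column_orth (P l) M \<Longrightarrow> row_orth (P l) M"
  shows "vanishing (insert s S) P W F (insert s (E - {l})) w' \<longleftrightarrow> vanishing S P W F E w \<and> column_orth (P l) M"
proof -
  let ?S = "insert s S" and ?E = "insert s (E - {l})" and ?n = "P l"
  let ?N = "pair_corr S P W F E w" and ?N' = "pair_corr ?S P W F ?E w'"
  have sFE: "s \<notin> F" "s \<notin> E" using s F E by auto
  have lS: "l \<in> S" using l E by auto
  have finA: "finite (assigns S P)" using fin by simp
  have disS: "dissociated S P W"
    using dissociated_subset[OF dis _ _ P(2)] fin by blast
  \<comment> \<open>The matrix product that describes the step: \<open>l\<close> is released and
    \<open>s\<close> becomes prescribed, so the former end values \<open>u\<close>,
    \<open>u'\<close> are summed over, at the distance lowered by the contribution of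
    \<open>s\<close>.\<close>
  have eq: "?N' \<tau> \<alpha> \<beta> = (if \<alpha> s < ?n \<and> \<beta> s < ?n then
      \<Sum>u<?n. \<Sum>u'<?n. M u (\<alpha> s) * cnj (M u' (\<beta> s)) *
        ?N (\<tau> - (int (\<beta> s) - int (\<alpha> s)) * W s) (\<alpha>(l := u)) (\<beta>(l := u')) else 0)"
    (is "_ = ?rhs") for \<tau> \<alpha> \<beta>
  proof -
    let ?c = "\<lambda>x y a b. agree F x y \<and> shift S W x y = \<tau> - (int b - int a) * W s"
    let ?t = "\<lambda>x y a b. if ?c x y a b \<and> agree (E - {l}) x \<alpha> \<and> agree (E - {l}) y \<beta>
        then (w x * M (x l) a) * cnj (w y * M (y l) b) else 0"
    have "?N' \<tau> \<alpha> \<beta> = (\<Sum>a<?n. \<Sum>x\<in>assigns S P. \<Sum>b<?n. \<Sum>y\<in>assigns S P.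
        if b = \<beta> s then if a = \<alpha> s then ?t x y a b else 0 else 0)"
      unfolding pair_corr_def sum_assigns_insert[OF fin s] P(1)
      by (intro sum.cong refl) (auto simp: agree_insert sFE shift_insert_upd[OF fin s] w')
    also have "\<dots> = (\<Sum>a<?n. \<Sum>x\<in>assigns S P. \<Sum>b<?n. if b = \<beta> s then
        \<Sum>y\<in>assigns S P. if a = \<alpha> s then ?t x y a b else 0 else 0)"
      by (intro sum.cong refl) simp
    also have "\<dots> = (\<Sum>a<?n. if a = \<alpha> s then if \<beta> s < ?n then
       \<Sum>x\<in>assigns S P. \<Sum>y\<in>assigns S P. ?t x y a (\<beta> s) else 0 else 0)"
      by (intro sum.cong refl) simp
    also have "\<dots> = (if \<alpha> s < ?n \<and> \<beta> s < ?n then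
       \<Sum>x\<in>assigns S P. \<Sum>y\<in>assigns S P. ?t x y (\<alpha> s) (\<beta> s) else 0)"
      by simp
    also have "(\<Sum>x\<in>assigns S P. \<Sum>y\<in>assigns S P. ?t x y (\<alpha> s) (\<beta> s)) =
      (\<Sum>x\<in>assigns S P. \<Sum>y\<in>assigns S P. \<Sum>u<?n. \<Sum>u'<?n.
        if ?c x y (\<alpha> s) (\<beta> s) \<and> agree E x (\<alpha>(l := u)) \<and> agree E y (\<beta>(l := u'))
        then (w x * M u (\<alpha> s)) * cnj (w y * M u' (\<beta> s)) else 0)" (is "?L = ?R")
    proof (intro sum.cong refl)
      fix x y assume xy: "x \<in> assigns S P" "y \<in> assigns S P"
      let ?q = "\<lambda>u u'. (w x * M u (\<alpha> s)) * cnj (w y * M u' (\<beta> s))"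
      have Y: "(if agree (E - {l}) y \<beta> then ?q u (y l) else 0) = (\<Sum>u'<?n. if agree E y (\<beta>(l := u')) then ?q u u' else 0)" for u
        by (rule sum_agree_upd[OF l lS fin xy(2), of \<beta> "?q u"])
      have XY: "(if agree (E - {l}) x \<alpha> then if agree (E - {l}) y \<beta> then ?q (x l) (y l) else 0 else 0)
        = (\<Sum>u<?n. if agree E x (\<alpha>(l := u)) then \<Sum>u'<?n. if agree E y (\<beta>(l := u')) then ?q u u' else 0 else 0)"
        unfolding Y[symmetric]
        by (rule sum_agree_upd[OF l lS fin xy(1), of \<alpha> "\<lambda>u. if agree (E - {l}) y \<beta> then ?q u (y l) else 0"])
      have "?t x y (\<alpha> s) (\<beta> s) = (if ?c x y (\<alpha> s) (\<beta> s) then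
          if agree (E - {l}) x \<alpha> then if agree (E - {l}) y \<beta> then ?q (x l) (y l) else 0 else 0 else 0)"
        by simp
      also have "\<dots> = (if ?c x y (\<alpha> s) (\<beta> s) then
          \<Sum>u<?n. if agree E x (\<alpha>(l := u)) then \<Sum>u'<?n. if agree E y (\<beta>(l := u')) then ?q u u' else 0 else 0 else 0)"
        by (simp only: XY)
      also have "\<dots> = (\<Sum>u<?n. \<Sum>u'<?n. if ?c x y (\<alpha> s) (\<beta> s) \<and> agree E x (\<alpha>(l := u)) \<and> agree E y (\<beta>(l := u'))
        then ?q u u' else 0)"
        by (auto intro!: sum.cong)
      finally show "?t x y (\<alpha> s) (\<beta> s) = \<dots>" .
    qed
    also have "?R = (\<Sum>x\<in>assigns S P. \<Sum>u<?n. \<Sum>y\<in>assigns S P. \<Sum>u'<?n.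
        if ?c x y (\<alpha> s) (\<beta> s) \<and> agree E x (\<alpha>(l := u)) \<and> agree E y (\<beta>(l := u'))
        then (w x * M u (\<alpha> s)) * cnj (w y * M u' (\<beta> s)) else 0)"
      by (intro sum.cong refl sum.swap)
    also have "\<dots> = (\<Sum>u<?n. \<Sum>x\<in>assigns S P. \<Sum>y\<in>assigns S P. \<Sum>u'<?n.
        if ?c x y (\<alpha> s) (\<beta> s) \<and> agree E x (\<alpha>(l := u)) \<and> agree E y (\<beta>(l := u'))
        then (w x * M u (\<alpha> s)) * cnj (w y * M u' (\<beta> s)) else 0)"
      by (rule sum.swap)
    also have "\<dots> = (\<Sum>u<?n. \<Sum>x\<in>assigns S P. \<Sum>u'<?n. \<Sum>y\<in>assigns S P.
        if ?c x y (\<alpha> s) (\<beta> s) \<and> agree E x (\<alpha>(l := u)) \<and> agree E y (\<beta>(l := u'))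
        then (w x * M u (\<alpha> s)) * cnj (w y * M u' (\<beta> s)) else 0)"
      by (intro sum.cong refl sum.swap)
    also have "\<dots> = (\<Sum>u<?n. \<Sum>u'<?n. \<Sum>x\<in>assigns S P. \<Sum>y\<in>assigns S P.
        if ?c x y (\<alpha> s) (\<beta> s) \<and> agree E x (\<alpha>(l := u)) \<and> agree E y (\<beta>(l := u'))
        then (w x * M u (\<alpha> s)) * cnj (w y * M u' (\<beta> s)) else 0)"
      by (intro sum.cong refl sum.swap)
    also have "\<dots> = (\<Sum>u<?n. \<Sum>u'<?n. M u (\<alpha> s) * cnj (M u' (\<beta> s)) *
        ?N (\<tau> - (int (\<beta> s) - int (\<alpha> s)) * W s) (\<alpha>(l := u)) (\<beta>(l := u')))"
      unfolding pair_corr_def sum_distrib_left by (intro sum.cong refl) auto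
    finally show ?thesis .
  qed
  \<comment> \<open>At distance zero the correlations, as a matrix in \<open>u\<close> and
    \<open>u'\<close>, are a multiple of the identity.\<close>
  have zero: "?N 0 (\<alpha>(l := u)) (\<beta>(l := u')) = (if agree (E - {l}) \<alpha> \<beta> \<and> u = u' then of_nat (\<Prod>r\<in>S - E. P r) else 0)"
    if "\<And>r. r \<in> E \<Longrightarrow> \<alpha> r < P r" "u < ?n" for \<alpha> \<beta> u u'
  proof -
    have "agree E (\<alpha>(l := u)) (\<beta>(l := u')) \<longleftrightarrow> agree (E - {l}) \<alpha> \<beta> \<and> u = u'"
      using l unfolding agree_def by auto
    then show ?thesis using pair_corr_0[OF fin E disS w, where \<alpha> = "\<alpha>(l := u)" and F = F and \<beta> = "\<beta>(l := u')"] that by simp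
  qed
  have out: "?N \<tau> \<alpha> \<beta> = 0" if "r \<in> E" "\<not> \<alpha> r < P r" for \<tau> \<alpha> \<beta> r
  proof -
    have "\<not> agree E x \<alpha>" if "x \<in> assigns S P" for x
      using assigns_less[OF that, of r] \<open>r \<in> E\<close> \<open>\<not> \<alpha> r < P r\<close> E unfolding agree_def by force
    then show ?thesis unfolding pair_corr_def by simp
  qed
  show ?thesis
  proof (intro iffI conjI)
    assume V: "vanishing S P W F E w \<and> column_orth ?n M"
    show "vanishing ?S P W F ?E w'" unfolding vanishing_def
    proof (intro allI impI)
      fix \<tau> :: int and \<alpha> \<beta> :: "'a \<Rightarrow> nat" assume \<tau>: "\<tau> \<noteq> 0"
      let ?a = "\<alpha> s" and ?b = "\<beta> s"
      let ?\<tau> = "\<tau> - (int ?b - int ?a) * W s"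
      show "?N' \<tau> \<alpha> \<beta> = 0"
      \<comment> \<open>The critical case is lowered distance zero with admissible prescriptions:
        there \<open>\<tau> \<noteq> 0\<close> forces \<open>?a \<noteq> ?b\<close>, and the column
        inner product appears.\<close>
      proof (cases "?a < ?n \<and> ?b < ?n \<and> ?\<tau> = 0 \<and> (\<forall>r\<in>E - {l}. \<alpha> r < P r)")
        case True
        then have "?a \<noteq> ?b" using \<tau> by auto
        \<comment> \<open>The entry at \<open>l\<close> is overwritten by \<open>u\<close> in any
          case; resetting it makes the whole prescription admissible.\<close>
        define \<alpha>' where "\<alpha>' = \<alpha>(l := 0)"
        have in': "\<alpha>' r < P r" if "r \<in> E" for r using True that P(2) lS unfolding \<alpha>'_def by auto
        have upd: "\<alpha>(l := u) = \<alpha>'(l := u)" for u unfolding \<alpha>'_def by simp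
        let ?C = "if agree (E - {l}) \<alpha>' \<beta> then of_nat (\<Prod>r\<in>S - E. P r) else 0 :: complex"
        have "?N' \<tau> \<alpha> \<beta> = (\<Sum>u<?n. \<Sum>u'<?n. M u ?a * cnj (M u' ?b) * ?N 0 (\<alpha>'(l := u)) (\<beta>(l := u')))"
          unfolding eq upd using True by simp
        also have "\<dots> = (\<Sum>u<?n. \<Sum>u'<?n. if u' = u then M u ?a * cnj (M u' ?b) * ?C else 0)"
          by (intro sum.cong refl) (simp add: zero[OF in'])
        also have "\<dots> = (\<Sum>u<?n. M u ?a * cnj (M u ?b)) * ?C"
          by (simp add: sum_distrib_right)
        also have "\<dots> = 0" using V True \<open>?a \<noteq> ?b\<close> unfolding column_orth_def by simp
        finally show ?thesis .
      next
        case False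
        have "?N ?\<tau> (\<alpha>(l := u)) (\<beta>(l := u')) = 0" if ab: "?a < ?n" "?b < ?n" for u u'
        proof (cases "?\<tau> = 0")
          case True
          then obtain r where "r \<in> E - {l}" "\<not> \<alpha> r < P r" using False ab by auto
          then show ?thesis by (intro out[of r]) auto
        next
          case False
          then show ?thesis using V unfolding vanishing_def by blast
        qed
        then show ?thesis unfolding eq by simp
      qed
    qed
  next
    assume V: "vanishing ?S P W F ?E w'"
    show orth: "column_orth ?n M" unfolding column_orth_def
    proof (intro allI impI)
      fix a b assume ab: "a < ?n" "b < ?n" "a \<noteq> b"
      let ?\<alpha> = "(\<lambda>_. 0)(s := a)" and ?\<beta> = "(\<lambda>_. 0)(s := b)"
      \<comment> \<open>The distance of two assignments differing only at \<open>s\<close>, with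
        values \<open>a\<close> and \<open>b\<close>; the edge lowers it to zero, so
        \<open>N\<close> there is the known diagonal matrix.\<close>
      let ?\<tau> = "(int b - int a) * W s"
      \<comment> \<open>With weight 0 at \<open>s\<close>, the zero assignment and the one with a
        single 1 at \<open>s\<close> would be distinct at distance zero. The value 1 is admissible
        because two distinct values \<open>a\<close>, \<open>b\<close> exist.\<close>
      have Ws: "W s \<noteq> 0"
      proof
        assume W0: "W s = 0"
        let ?x = "(\<lambda>r\<in>?S. 0)" and ?y = "(\<lambda>r\<in>?S. if r = s then 1 else 0 :: nat)"
        have "1 < P s" using ab P(1) by simp
        then have "?x \<in> assigns ?S P" "?y \<in> assigns ?S P"
          using P(2) unfolding assigns_def by auto
        moreover have "shift ?S W ?x ?y = 0"
          unfolding shift_def using W0 by (intro sum.neutral) auto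
        ultimately have "?x = ?y" using dis unfolding dissociated_def by blast
        from fun_cong[OF this, of s] show False by simp
      qed
      then have "?\<tau> \<noteq> 0" using ab by simp
      then have N'0: "?N' ?\<tau> ?\<alpha> ?\<beta> = 0" using V unfolding vanishing_def by blast
      have N0: "?N 0 (?\<alpha>(l := u)) (?\<beta>(l := u')) = (if u = u' then of_nat (\<Prod>r\<in>S - E. P r) else 0)"
        if "u < ?n" for u u'
      proof -
        have "agree (E - {l}) ?\<alpha> ?\<beta>" unfolding agree_def using sFE by auto
        moreover have "?\<alpha> r < P r" if "r \<in> E" for r using that sFE E P(2) by auto
        ultimately show ?thesis using zero[of ?\<alpha> u ?\<beta> u'] that by simp
      qed
      have "0 = (\<Sum>u<?n. \<Sum>u'<?n. M u a * cnj (M u' b) * ?N 0 (?\<alpha>(l := u)) (?\<beta>(l := u')))"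
        using N'0 ab unfolding eq by simp
      also have "\<dots> = (\<Sum>u<?n. \<Sum>u'<?n. if u' = u then M u a * cnj (M u' b) * of_nat (\<Prod>r\<in>S - E. P r) else 0)"
        by (intro sum.cong refl) (simp add: N0)
      also have "\<dots> = (\<Sum>u<?n. M u a * cnj (M u b)) * of_nat (\<Prod>r\<in>S - E. P r)"
        by (simp add: sum_distrib_right)
      finally have "(\<Sum>u<?n. M u a * cnj (M u b)) = 0 \<or> (\<Prod>r\<in>S - E. P r) = 0"
        by (metis mult_eq_0_iff of_nat_eq_0_iff)
      moreover have "(\<Prod>r\<in>S - E. P r) \<noteq> 0" using P(2) fin by auto
      ultimately show "(\<Sum>u<?n. M u a * cnj (M u b)) = 0" by blast
    qed
    have rowM: "(\<Sum>a<?n. M u a * cnj (M v a)) = (if u = v then of_nat ?n else 0)" if "u < ?n" "v < ?n" for u v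
      using row[OF orth] that mult_cnj_eq_1[OF M] unfolding row_orth_def column_orth_def by simp
    show "vanishing S P W F E w" unfolding vanishing_def
    proof (intro allI impI)
      fix \<tau> :: int and \<alpha> \<beta> :: "'a \<Rightarrow> nat" assume \<tau>: "\<tau> \<noteq> 0"
      let ?K = "\<lambda>u u'. ?N \<tau> (\<alpha>(l := u)) (\<beta>(l := u'))"
      have inv: "(\<Sum>u<?n. \<Sum>u'<?n. M u a * cnj (M u' b) * ?K u u') = 0" if ab: "a < ?n" "b < ?n" for a b
      proof -
        let ?\<alpha> = "\<alpha>(s := a)" and ?\<beta> = "\<beta>(s := b)"
        \<comment> \<open>Chosen so that the edge lowers it to the given \<open>\<tau>\<close>; it
          depends on \<open>a\<close> and \<open>b\<close>, so every entry of the transformed matrix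
          is read at its own distance.\<close>
        let ?\<tau> = "\<tau> + (int b - int a) * W s"
        have sl: "s \<noteq> l" using lS s by auto
        have N: "?N \<tau> (?\<alpha>(l := u)) (?\<beta>(l := u')) = ?K u u'" for u u'
          using sFE sl unfolding pair_corr_def by (simp add: fun_upd_twist[of s l])
        have "(\<Sum>u<?n. \<Sum>u'<?n. M u a * cnj (M u' b) * ?K u u') = ?N' ?\<tau> ?\<alpha> ?\<beta>"
          unfolding eq using ab N by simp
        also have "\<dots> = 0"
        proof (cases "?\<tau> = 0")
          case False then show ?thesis using V unfolding vanishing_def by blast
        next
          case True
          \<comment> \<open>At distance zero the hypothesis is silent, but only equal pairs occur
            there, and these cannot end in two different values \<open>a\<close> and
            \<open>b\<close>.\<close>
          then have "a \<noteq> b" using \<tau> by auto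
          then have na: "\<not> agree ?E ?\<alpha> ?\<beta>" unfolding agree_def by auto
          have nw': "norm (w' x) = 1" if "x \<in> assigns ?S P" for x
          proof -
            obtain y c where "x = y(s := c)" "y \<in> assigns S P"
              using \<open>x \<in> assigns ?S P\<close> unfolding assigns_def PiE_insert_eq by auto
            then show ?thesis using w' w M by (simp add: norm_mult)
          qed
          show ?thesis
          proof (cases "\<forall>r\<in>?E. ?\<alpha> r < P r")
            case rng: True
            have "finite ?S" "?E \<subseteq> ?S" using fin E by auto
            from pair_corr_0[where w = w' and F = F and \<alpha> = ?\<alpha> and \<beta> = ?\<beta>, OF this dis nw' bspec[OF rng]]
            have "?N' 0 ?\<alpha> ?\<beta> = 0" using na by simp
            then show ?thesis using True by simp
          next
            case False
            then obtain r where r: "r \<in> ?E" "\<not> ?\<alpha> r < P r" by blast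
            then have "r \<noteq> s" using ab P(1) by auto
            then have "r \<in> E" "r \<noteq> l" "\<not> \<alpha> r < P r" using r by auto
            then have "?N t (?\<alpha>(l := u)) y = 0" for t u y
              using \<open>r \<noteq> s\<close> by (intro out[of r]) auto
            then show ?thesis unfolding eq by simp
          qed
        qed
        finally show ?thesis .
      qed
      show "?N \<tau> \<alpha> \<beta> = 0"
      proof (cases "\<alpha> l < ?n \<and> \<beta> l < ?n")
        case True
        let ?v = "\<alpha> l" and ?v' = "\<beta> l"
        \<comment> \<open>Inversion of the matrix product on both sides: row orthogonality isolates
          the entry at \<open>?v\<close>, \<open>?v'\<close>, with the nonzero factor
          \<open>?n\<close> squared.\<close>
        have "0 = (\<Sum>a<?n. \<Sum>b<?n. (cnj (M ?v a) * M ?v' b) * (\<Sum>u<?n. \<Sum>u'<?n. M u a * cnj (M u' b) * ?K u u'))"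
          using inv by simp
        also have "\<dots> = (\<Sum>a<?n. \<Sum>b<?n. \<Sum>u<?n. \<Sum>u'<?n. (M u a * cnj (M ?v a)) * cnj (M u' b * cnj (M ?v' b)) * ?K u u')"
          by (simp add: sum_distrib_left mult_ac)
        also have "\<dots> = (\<Sum>a<?n. \<Sum>u<?n. \<Sum>b<?n. \<Sum>u'<?n. (M u a * cnj (M ?v a)) * cnj (M u' b * cnj (M ?v' b)) * ?K u u')"
          by (intro sum.cong refl sum.swap)
        also have "\<dots> = (\<Sum>u<?n. \<Sum>a<?n. \<Sum>b<?n. \<Sum>u'<?n. (M u a * cnj (M ?v a)) * cnj (M u' b * cnj (M ?v' b)) * ?K u u')"
          by (rule sum.swap)
        also have "\<dots> = (\<Sum>u<?n. \<Sum>a<?n. \<Sum>u'<?n. \<Sum>b<?n. (M u a * cnj (M ?v a)) * cnj (M u' b * cnj (M ?v' b)) * ?K u u')"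
          by (intro sum.cong refl sum.swap)
        also have "\<dots> = (\<Sum>u<?n. \<Sum>u'<?n. \<Sum>a<?n. \<Sum>b<?n. (M u a * cnj (M ?v a)) * cnj (M u' b * cnj (M ?v' b)) * ?K u u')"
          by (intro sum.cong refl sum.swap)
        also have "\<dots> = (\<Sum>u<?n. \<Sum>u'<?n. (\<Sum>a<?n. M u a * cnj (M ?v a)) * cnj (\<Sum>b<?n. M u' b * cnj (M ?v' b)) * ?K u u')"
          unfolding cnj_sum sum_product by (simp only: sum_distrib_right)
        also have "\<dots> = (\<Sum>u<?n. \<Sum>u'<?n. if u' = ?v' then if u = ?v then of_nat ?n * of_nat ?n * ?K u u' else 0 else 0)"
          by (intro sum.cong refl) (use rowM True in auto)
        also have "\<dots> = of_nat ?n * of_nat ?n * ?K ?v ?v'" using True by simp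
        finally show ?thesis using True by simp
      next
        case False
        have "\<not> (agree E x \<alpha> \<and> agree E y \<beta>)" if "x \<in> assigns S P" "y \<in> assigns S P" for x y
          using assigns_less[OF that(1) lS] assigns_less[OF that(2) lS] l False unfolding agree_def by auto
        then show ?thesis unfolding pair_corr_def by (intro sum.neutral ballI if_not_P) blast
      qed
    qed
  qed
qed

subsection \<open>Chains of paths\<close>

definition positions :: "nat \<Rightarrow> (nat \<Rightarrow> nat) \<Rightarrow> (nat \<times> nat) set" where
  "positions k N = (SIGMA i:{1..k}. {1..N i})"

definition firsts :: "nat \<Rightarrow> (nat \<times> nat) set" where
  "firsts k = (\<lambda>i. (i, 1)) ` {1..k}"

definition lasts :: "nat \<Rightarrow> (nat \<Rightarrow> nat) \<Rightarrow> (nat \<times> nat) set" where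
  "lasts k N = (\<lambda>i. (i, N i)) ` {1..k}"

text \<open>In block \<open>1\<close> the first argument of \<open>\<kappa>\<close> is a junk value, which \<open>\<kappa> 1\<close> has to ignore.\<close>

definition path_weight where
  "path_weight N \<kappa> M i v x =
    \<kappa> i (x (i - 1, N (i - 1))) (x (i, 1)) * (\<Prod>j=1..<v. M i j (x (i, j)) (x (i, j + 1)) :: complex)"

definition chain_weight where
  "chain_weight k N \<kappa> M x = (\<Prod>i=1..k. path_weight N \<kappa> M i (N i) x)"

lemma finite_positions [simp]: "finite (positions k N)"
  unfolding positions_def by simp

text \<open>Ensures that assigning a variable of the next block leaves the weight of the completed
  blocks unchanged.\<close>

lemma chain_weight_cong:
  assumes N: "\<And>i. i \<in> {1..k} \<Longrightarrow> 1 \<le> N i" and \<kappa>: "\<And>a a' b. \<kappa> 1 a b = \<kappa> 1 a' b"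
    and xy: "\<And>s. s \<in> positions k N \<Longrightarrow> x s = y s"
  shows "chain_weight k N \<kappa> M x = chain_weight k N \<kappa> M y"
  unfolding chain_weight_def
proof (rule prod.cong[OF refl])
  fix i assume i: "i \<in> {1..k}"
  have "\<kappa> i (x (i - 1, N (i - 1))) (x (i, 1)) = \<kappa> i (y (i - 1, N (i - 1))) (y (i, 1))"
  proof (cases "i = 1")
    case True
    have "x (1, 1) = y (1, 1)" using i N True by (intro xy) (auto simp: positions_def)
    then show ?thesis using True \<kappa> by metis
  next
    case False
    then have "i - 1 \<in> {1..k}" using i by auto
    then have "x (i - 1, N (i - 1)) = y (i - 1, N (i - 1))" "x (i, 1) = y (i, 1)"
      using i N[of "i - 1"] N[of i] by (intro xy; auto simp: positions_def)+
    then show ?thesis by simp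
  qed
  moreover have "M i j (x (i, j)) (x (i, j + 1)) = M i j (y (i, j)) (y (i, j + 1))" if "j \<in> {1..<N i}" for j
    using xy[of "(i, j)"] xy[of "(i, j + 1)"] i that by (simp add: positions_def)
  ultimately show "path_weight N \<kappa> M i (N i) x = path_weight N \<kappa> M i (N i) y"
    unfolding path_weight_def by simp
qed

lemma vanishing_empty: "vanishing {} P W F E w"
  unfolding vanishing_def pair_corr_def by (auto simp: shift_def intro!: sum.neutral)

text \<open>Two nested inductions, over the blocks and along the path of the current block. The
  prescribed set always consists of the ends of the completed paths and the current end of the
  growing one, which is what each next factor reads.\<close>

theorem vanishing_chain:
  fixes k :: nat and N p :: "nat \<Rightarrow> nat"
  defines "P \<equiv> \<lambda>s::nat \<times> nat. p (fst s)"
  assumes N: "\<And>i. i \<in> {1..k} \<Longrightarrow> 1 \<le> N i" and p: "\<And>i. i \<in> {1..k} \<Longrightarrow> 0 < p i"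
    and \<kappa>: "\<And>i a b. norm (\<kappa> i a b) = 1" "\<And>a a' b. \<kappa> 1 a b = \<kappa> 1 a' b"
    and M: "\<And>i j a b. norm (M i j a b) = 1"
    and row: "\<And>i j. i \<in> {1..k} \<Longrightarrow> j \<in> {1..<N i} \<Longrightarrow> column_orth (p i) (M i j) \<Longrightarrow> row_orth (p i) (M i j)"
    and dis: "dissociated (positions k N) P W"
  shows "vanishing (positions k N) P W (firsts k) (lasts k N) (chain_weight k N \<kappa> M) \<longleftrightarrow>
    (\<forall>i\<in>{1..k}. \<forall>j\<in>{1..<N i}. column_orth (p i) (M i j))"
proof -
  have np: "norm (path_weight N \<kappa> M i v x) = 1" for i v x
    unfolding path_weight_def by (simp add: norm_mult \<kappa> M flip: prod_norm)
  have nc: "norm (chain_weight i N \<kappa> M x) = 1" for i x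
    unfolding chain_weight_def by (simp add: np flip: prod_norm)
  have "i \<le> k \<Longrightarrow> vanishing (positions i N) P W (firsts i) (lasts i N) (chain_weight i N \<kappa> M) \<longleftrightarrow>
    (\<forall>i'\<in>{1..i}. \<forall>j\<in>{1..<N i'}. column_orth (p i') (M i' j))" for i
  proof (induction i)
    case 0
    have "positions 0 N = {}" unfolding positions_def by simp
    then show ?case by (simp add: vanishing_empty)
  next
    case (Suc i)
    let ?i = "Suc i"
    have ik: "?i \<in> {1..k}" using Suc.prems by simp
    \<comment> \<open>All positions of the completed blocks and the first \<open>v\<close> positions
      of the next one.\<close>
    define T where "T v = positions i N \<union> {?i} \<times> {1..v}" for v
    define w where "w v x = chain_weight i N \<kappa> M x * path_weight N \<kappa> M ?i v x" for v x
    have sub: "positions i N \<subseteq> positions k N" using Suc.prems unfolding positions_def by auto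
    have Tsub: "T v \<subseteq> positions k N" if "v \<le> N ?i" for v
      using sub Suc.prems that unfolding T_def positions_def by auto
    have Ppos: "0 < P s" if "s \<in> positions k N" for s using that p unfolding P_def positions_def by auto
    have FE: "firsts i \<subseteq> positions i N" "lasts i N \<subseteq> positions i N"
      using N Suc.prems unfolding firsts_def lasts_def positions_def by auto
    have new: "(?i, v) \<notin> positions i N" for v unfolding positions_def by auto
    have chain_upd: "chain_weight i N \<kappa> M (x((?i, v) := a)) = chain_weight i N \<kappa> M x" for x v a
    proof (rule chain_weight_cong)
      show "1 \<le> N i'" if "i' \<in> {1..i}" for i' using that N Suc.prems by simp
      show "(x((?i, v) := a)) s = x s" if "s \<in> positions i N" for s using that new by auto
    qed (rule \<kappa>(2))
    have "v \<le> N ?i \<Longrightarrow> vanishing (T v) P W (insert (?i, 1) (firsts i)) (insert (?i, v) (lasts i N)) (w v) \<longleftrightarrow>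
      vanishing (positions i N) P W (firsts i) (lasts i N) (chain_weight i N \<kappa> M) \<and>
      (\<forall>j\<in>{1..<v}. column_orth (p ?i) (M ?i j))" if "1 \<le> v" for v
      using that
    proof (induction v rule: dec_induct)
      case base
      define \<nu> where "\<nu> x a = \<kappa> ?i (x (i, N i)) a" for x :: "nat \<times> nat \<Rightarrow> nat" and a
      have T1: "T 1 = insert (?i, 1) (positions i N)" unfolding T_def by auto
      have "vanishing (T 1) P W (insert (?i, 1) (firsts i)) (insert (?i, 1) (lasts i N)) (w 1) \<longleftrightarrow>
        vanishing (positions i N) P W (firsts i) (lasts i N) (chain_weight i N \<kappa> M)"
        unfolding T1
      proof (rule vanishing_insert_first[where \<nu> = \<nu>])
        show "0 < P (?i, 1)" unfolding P_def using p[OF ik] by simp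
        show "w 1 (x((?i, 1) := a)) = chain_weight i N \<kappa> M x * \<nu> x a" for x a
          unfolding w_def \<nu>_def path_weight_def chain_upd by simp
        show "norm (\<nu> x a) = 1" for x a unfolding \<nu>_def by (rule \<kappa>)
        \<comment> \<open>The coupling reads the end of the previous path, which is prescribed; the
          very first block has no previous path, and \<open>\<kappa> 1\<close> ignores that
          argument.\<close>
        show "\<nu> x a = \<nu> y a" if "agree (lasts i N) x y" for x y a
        proof (cases "i = 0")
          case True then show ?thesis unfolding \<nu>_def using \<kappa>(2) by simp
        next
          case False
          then have "(i, N i) \<in> lasts i N" unfolding lasts_def by auto
          then show ?thesis using that unfolding \<nu>_def agree_def by simp
        qed
      qed (use FE new in auto)
      then show ?case by simp
    next
      case (step v)
      let ?s = "(?i, Suc v)" and ?l = "(?i, v)"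
      have TS: "T (Suc v) = insert ?s (T v)" unfolding T_def by auto
      \<comment> \<open>Growing the path replaces its old end \<open>?l\<close> by
        \<open>?s\<close>. The set is rewritten as the result of removing \<open>?l\<close>, the
        form produced by an edge.\<close>
      have lE: "insert ?s (lasts i N) = insert ?s (insert ?l (lasts i N) - {?l})"
        using FE(2) new by auto
      have "vanishing (T (Suc v)) P W (insert (?i, 1) (firsts i)) (insert ?s (lasts i N)) (w (Suc v)) \<longleftrightarrow>
        vanishing (T v) P W (insert (?i, 1) (firsts i)) (insert ?l (lasts i N)) (w v) \<and> column_orth (P ?l) (M ?i v)"
        unfolding TS lE
      proof (rule vanishing_insert_edge)
        show "finite (T v)" unfolding T_def by simp
        show "?s \<notin> T v" unfolding T_def using new by auto
        show "insert (?i, 1) (firsts i) \<subseteq> T v" "insert ?l (lasts i N) \<subseteq> T v"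
          unfolding T_def using FE step.hyps by auto
        show "0 < P r" if "r \<in> insert ?s (T v)" for r
          using that Tsub[OF step.prems] Ppos unfolding TS by blast
        show "dissociated (insert ?s (T v)) P W" unfolding TS[symmetric]
          using dissociated_subset[OF dis Tsub[OF step.prems]] Ppos by simp
        show "w (Suc v) (x(?s := a)) = w v x * M ?i v (x ?l) a" for x a
          using step.hyps unfolding w_def chain_upd path_weight_def by simp
        show "column_orth (P ?l) (M ?i v) \<Longrightarrow> row_orth (P ?l) (M ?i v)"
          unfolding P_def using row[OF ik, of v] step by simp
      qed (auto simp: P_def w_def norm_mult np nc M)
      also have "\<dots> \<longleftrightarrow> vanishing (positions i N) P W (firsts i) (lasts i N) (chain_weight i N \<kappa> M) \<and>
        (\<forall>j\<in>{1..<Suc v}. column_orth (p ?i) (M ?i j))"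
        using step.IH step.prems step.hyps by (auto simp: P_def less_Suc_eq)
      finally show ?case .
    qed
    from this[OF N[OF ik] order_refl]
    have "vanishing (T (N ?i)) P W (insert (?i, 1) (firsts i)) (insert (?i, N ?i) (lasts i N)) (w (N ?i)) \<longleftrightarrow>
      (\<forall>i'\<in>{1..i}. \<forall>j\<in>{1..<N i'}. column_orth (p i') (M i' j)) \<and> (\<forall>j\<in>{1..<N ?i}. column_orth (p ?i) (M ?i j))"
      using Suc by simp
    moreover have "T (N ?i) = positions ?i N" unfolding T_def positions_def by (auto simp: le_Suc_eq)
    moreover have "insert (?i, 1) (firsts i) = firsts ?i" "insert (?i, N ?i) (lasts i N) = lasts ?i N"
      unfolding firsts_def lasts_def by (simp_all add: atLeastAtMostSuc_conv)
    moreover have "w (N ?i) = chain_weight ?i N \<kappa> M" unfolding w_def chain_weight_def by (simp add: fun_eq_iff)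
    moreover have "{1..?i} = insert ?i {1..i}" by auto
    ultimately show ?case by auto
  qed
  from this[OF order_refl] show ?thesis .
qed

subsection \<open>Coordinates of points\<close>

lemma offset_add_le: "1 \<le> i \<Longrightarrow> i < i' \<Longrightarrow> offset m i + m i \<le> offset m i'"
proof -
  assume "1 \<le> i" "i < i'"
  then have "offset m i + m i = (\<Sum>\<alpha>\<in>insert i {1..<i}. m \<alpha>)" unfolding offset_def by simp
  also have "\<dots> \<le> offset m i'"
    unfolding offset_def by (rule sum_mono2) (use \<open>1 \<le> i\<close> \<open>i < i'\<close> in auto)
  finally show ?thesis .
qed

lemma block_eq_image: "block m i = (\<lambda>j. offset m i + j) ` {1..m i}"
  unfolding block_def by (simp add: image_add_atLeastAtMost)

lemma UN_block: "(\<Union>i\<in>{1..k}. block m i) = {1..\<Sum>i=1..k. m i}"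
proof (induction k)
  case (Suc k)
  have "offset m (Suc k) = (\<Sum>i=1..k. m i)" unfolding offset_def atLeastLessThanSuc_atLeastAtMost ..
  then have "block m (Suc k) = {(\<Sum>i=1..k. m i) + 1..(\<Sum>i=1..k. m i) + m (Suc k)}" unfolding block_def by simp
  then show ?case using Suc by (auto simp: atLeastAtMostSuc_conv)
qed simp

lemma block_disjoint:
  assumes "1 \<le> i" "1 \<le> i'" "s \<in> block m i" "s \<in> block m i'"
  shows "i = i'"
  using offset_add_le[of i i' m] offset_add_le[of i' i m] assms unfolding block_def
  by (cases i i' rule: linorder_cases) auto

lemma offset_bij_betw: "bij_betw (\<lambda>(i, j). offset m i + j) (positions k m) {1..\<Sum>i=1..k. m i}"
  unfolding bij_betw_def
proof
  show "inj_on (\<lambda>(i, j). offset m i + j) (positions k m)"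
  proof (rule inj_onI)
    fix s s' assume s: "s \<in> positions k m" "s' \<in> positions k m"
      and eq: "(case s of (i, j) \<Rightarrow> offset m i + j) = (case s' of (i, j) \<Rightarrow> offset m i + j)"
    obtain i j i' j' where ij: "s = (i, j)" "s' = (i', j')" by (cases s, cases s')
    have *: "1 \<le> i" "1 \<le> i'" "offset m i + j \<in> block m i" "offset m i' + j' \<in> block m i'"
      using s unfolding ij positions_def block_def by auto
    have eq': "offset m i + j = offset m i' + j'" using eq unfolding ij by simp
    have "i = i'" using block_disjoint[OF *(1,2,3)] *(4) unfolding eq' .
    with eq' show "s = s'" unfolding ij by simp
  qed
  have "(\<lambda>(i, j). offset m i + j) ` positions k m = (\<Union>i\<in>{1..k}. (\<lambda>j. offset m i + j) ` {1..m i})"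
    unfolding positions_def Sigma_def image_UN by (intro SUP_cong refl) (auto simp: image_def)
  also have "\<dots> = (\<Union>i\<in>{1..k}. block m i)"
    unfolding block_eq_image ..
  finally show "(\<lambda>(i, j). offset m i + j) ` positions k m = {1..\<Sum>i=1..k. m i}" unfolding UN_block .
qed

lemma offset_in_range: "i \<in> {1..k} \<Longrightarrow> j \<in> {1..m i} \<Longrightarrow> offset m i + j \<in> {1..\<Sum>i=1..k. m i}"
proof -
  assume i: "i \<in> {1..k}" and "j \<in> {1..m i}"
  then have "offset m i + j \<in> block m i" unfolding block_def by simp
  with i show ?thesis unfolding UN_block[symmetric] by blast
qed

definition coord :: "nat \<Rightarrow> (nat \<Rightarrow> nat) \<Rightarrow> nat \<Rightarrow> nat \<times> nat" where
  "coord k m = the_inv_into (positions k m) (\<lambda>(i, j). offset m i + j)"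

lemma coord_offset: "i \<in> {1..k} \<Longrightarrow> j \<in> {1..m i} \<Longrightarrow> coord k m (offset m i + j) = (i, j)"
  unfolding coord_def
  using the_inv_into_f_f[OF bij_betw_imp_inj_on[OF offset_bij_betw[of m k]], of "(i, j)"] by (simp add: positions_def)

definition coord_weight :: "nat \<Rightarrow> (nat \<Rightarrow> nat) \<Rightarrow> (nat \<Rightarrow> nat) \<Rightarrow> nat \<Rightarrow> int" where
  "coord_weight k p m s = (case coord k m s of (i, j) \<Rightarrow> int (p i ^ (j - 1) * (\<Prod>\<alpha>=1..<i. p \<alpha> ^ m \<alpha>)))"

lemma point_label_eq_sum:
  "int (point_label k p m x) = (\<Sum>s=1..\<Sum>i=1..k. m i. int (x s) * coord_weight k p m s)"
proof -
  have "(\<Sum>s=1..\<Sum>i=1..k. m i. int (x s) * coord_weight k p m s)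
    = (\<Sum>(i, j)\<in>positions k m. int (x (offset m i + j)) * coord_weight k p m (offset m i + j))"
    unfolding sum.reindex_bij_betw[OF offset_bij_betw, symmetric] by (simp add: case_prod_unfold)
  also have "\<dots> = (\<Sum>(i, j)\<in>positions k m. int (x (offset m i + j)) * int (p i ^ (j - 1) * (\<Prod>\<alpha>=1..<i. p \<alpha> ^ m \<alpha>)))"
    by (rule sum.cong) (auto simp: coord_weight_def positions_def coord_offset)
  also have "\<dots> = int (point_label k p m x)"
    unfolding point_label_def label_def positions_def
    by (simp add: sum.Sigma sum_distrib_left sum_distrib_right mult_ac case_prod_unfold)
  finally show ?thesis by simp
qed

text \<open>The label is linear in the coordinates, with place values \<open>coord_weight\<close>;
  this identifies the lag between two entries of a sequence with a shift.\<close>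

lemma point_label_diff:
  "int (point_label k p m y) - int (point_label k p m x) = shift {1..\<Sum>i=1..k. m i} (coord_weight k p m) x y"
  unfolding point_label_eq_sum shift_def by (simp add: sum_subtractf left_diff_distrib)

lemma label_cong:
  "(\<And>i j. i \<in> {1..k} \<Longrightarrow> j \<in> {1..e i} \<Longrightarrow> v i j = w i j) \<Longrightarrow> label k p e v = label k p e w"
  unfolding label_def by (intro sum.cong arg_cong2[where f="(*)"] refl) auto

text \<open>Numbering the coordinates by block and place reduces the claim to labels of block
  vectors.\<close>

lemma point_label_bij_betw:
  assumes p: "\<And>i. i \<in> {1..k} \<Longrightarrow> 0 < p i"
  shows "bij_betw (point_label k p m) (points k p m) {..<\<Prod>i=1..k. p i ^ m i}"
proof -
  let ?u = "\<lambda>x. \<lambda>i\<in>{1..k}. \<lambda>j\<in>{1..m i}. x (offset m i + j)"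
  have u_mem: "?u x \<in> block_vecs k p m" if x: "x \<in> points k p m" for x
  proof -
    have "x (offset m i + j) < p i" if "i \<in> {1..k}" "j \<in> {1..m i}" for i j
      using x that unfolding points_def block_def by auto
    then show ?thesis unfolding block_vecs_def by auto
  qed
  have "bij_betw ?u (points k p m) (block_vecs k p m)"
    unfolding bij_betw_def
  proof
    show "inj_on ?u (points k p m)"
    proof (rule inj_onI)
      fix x y assume xy: "x \<in> points k p m" "y \<in> points k p m" "?u x = ?u y"
      show "x = y"
      proof (rule extensionalityI[where A = "{1..\<Sum>i=1..k. m i}"])
        fix s assume "s \<in> {1..\<Sum>i=1..k. m i}"
        then obtain i where i: "i \<in> {1..k}" "s \<in> block m i" unfolding UN_block[symmetric] by blast
        then obtain j where "j \<in> {1..m i}" "s = offset m i + j" unfolding block_eq_image by (elim imageE)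
        note ij = i(1) this
        have "?u x i j = ?u y i j" using xy(3) by simp
        then show "x s = y s" using ij by simp
      qed (use xy in \<open>auto simp: points_def\<close>)
    qed
    show "?u ` points k p m = block_vecs k p m"
    proof (intro equalityI subsetI)
      fix v assume "v \<in> ?u ` points k p m"
      then show "v \<in> block_vecs k p m" using u_mem by blast
    next
      fix v assume v: "v \<in> block_vecs k p m"
      define x where "x = (\<lambda>s\<in>{1..\<Sum>i=1..k. m i}. case coord k m s of (i, j) \<Rightarrow> v i j)"
      have xv: "x (offset m i + j) = v i j" if "i \<in> {1..k}" "j \<in> {1..m i}" for i j
      proof -
        from offset_in_range[where k = k and m = m, OF that]
        show ?thesis unfolding x_def using coord_offset[of i k j m] that by simp
      qed
      have "x \<in> points k p m" unfolding points_def
      proof (intro CollectI conjI ballI)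
        show "x \<in> extensional {1..\<Sum>i=1..k. m i}" unfolding x_def by simp
        fix i s assume i: "i \<in> {1..k}" and s: "s \<in> block m i"
        then have j: "s - offset m i \<in> {1..m i}" "s = offset m i + (s - offset m i)" unfolding block_def by auto
        then show "x s < p i" using xv[OF i j(1)] block_vecs_less[OF v i j(1)] by simp
      qed
      moreover have "v = ?u x"
        by (rule block_vecs_eqI[OF v u_mem[OF calculation]]) (simp add: xv)
      ultimately show "v \<in> ?u ` points k p m" by blast
    qed
  qed
  from bij_betw_trans[OF this label_bij_betw[where k = k and p = p and e = m, OF p]]
  have "bij_betw (label k p m \<circ> ?u) (points k p m) {..<\<Prod>i=1..k. p i ^ m i}" .
  moreover have "(label k p m \<circ> ?u) x = point_label k p m x" for x
    unfolding point_label_def comp_def by (rule label_cong) simp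
  ultimately show ?thesis by (simp cong: bij_betw_cong)
qed

subsection \<open>Correlations as sums over pairs\<close>

text \<open>Both sign cases of the aperiodic correlation run over the index pairs with difference
  \<open>\<tau>\<close>; the double sum treats them uniformly and can be reindexed by
  points.\<close>

lemma correlation_eq_pair_sum:
  assumes "length a = L" "length b = L" "\<bar>\<tau>\<bar> < int L"
  shows "correlation a b \<tau> = (\<Sum>r<L. \<Sum>s<L. if int s - int r = \<tau> then a ! r * cnj (b ! s) else 0)"
proof (cases "0 \<le> \<tau>")
  case True
  define t where "t = nat \<tau>"
  have eq: "int s - int r = \<tau> \<longleftrightarrow> s = r + t" for r s using True unfolding t_def by auto
  have "correlation a b \<tau> = (\<Sum>r<L - t. a ! r * cnj (b ! (r + t)))"
    unfolding correlation_def t_def using True assms by simp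
  also have "\<dots> = (\<Sum>r<L. if r + t < L then a ! r * cnj (b ! (r + t)) else 0)"
    by (rule sum.mono_neutral_cong_left) auto
  also have "\<dots> = (\<Sum>r<L. \<Sum>s<L. if int s - int r = \<tau> then a ! r * cnj (b ! s) else 0)"
    unfolding eq by simp
  finally show ?thesis .
next
  case False
  define t where "t = nat (- \<tau>)"
  have eq: "int s - int r = \<tau> \<longleftrightarrow> r = s + t" for r s using False unfolding t_def by auto
  have "correlation a b \<tau> = (\<Sum>s<L - t. a ! (s + t) * cnj (b ! s))"
    unfolding correlation_def t_def using False assms by simp
  also have "\<dots> = (\<Sum>s<L. if s + t < L then a ! (s + t) * cnj (b ! s) else 0)"
    by (rule sum.mono_neutral_cong_left) auto
  also have "\<dots> = (\<Sum>s<L. \<Sum>r<L. if int s - int r = \<tau> then a ! r * cnj (b ! s) else 0)"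
    unfolding eq by simp
  also have "\<dots> = (\<Sum>r<L. \<Sum>s<L. if int s - int r = \<tau> then a ! r * cnj (b ! s) else 0)"
    by (rule sum.swap)
  finally show ?thesis .
qed

lemma correlation_psi:
  assumes p: "\<And>i. i \<in> {1..k} \<Longrightarrow> 0 < p i" and q: "q = (\<Prod>i=1..k. p i)"
    and \<tau>: "\<bar>\<tau>\<bar> < int (\<Prod>i=1..k. p i ^ m i)"
  shows "correlation (psi k p m F) (psi k p m G) \<tau> =
    (\<Sum>x\<in>points k p m. \<Sum>y\<in>points k p m.
      if shift {1..\<Sum>i=1..k. m i} (coord_weight k p m) x y = \<tau>
      then root_of_unity q ^ F x * cnj (root_of_unity q ^ G y) else 0)"
proof -
  let ?X = "points k p m" and ?l = "point_label k p m" and ?L = "\<Prod>i=1..k. p i ^ m i"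
  note bij = point_label_bij_betw[where k = k and p = p and m = m, OF p]
  have inv: "point_of k p m (?l x) = x" if "x \<in> ?X" for x
    unfolding point_of_def using the_inv_into_f_f[OF bij_betw_imp_inj_on[OF bij] that] .
  have less: "?l x < ?L" if "x \<in> ?X" for x using bij_betwE[OF bij] that by blast
  have nth: "psi k p m F ! ?l x = root_of_unity q ^ F x" if "x \<in> ?X" for x F
    unfolding psi_def using less[OF that] inv[OF that] q by simp
  have R: "(\<Sum>r<?L. H r) = (\<Sum>x\<in>?X. H (?l x))" for H :: "nat \<Rightarrow> complex"
    using sum.reindex_bij_betw[OF bij, of H] by simp
  have len: "length (psi k p m F) = ?L" for F unfolding psi_def by simp
  have "correlation (psi k p m F) (psi k p m G) \<tau> =
      (\<Sum>r<?L. \<Sum>s<?L. if int s - int r = \<tau> then psi k p m F ! r * cnj (psi k p m G ! s) else 0)"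
    by (rule correlation_eq_pair_sum[OF len len \<tau>])
  also have "\<dots> = (\<Sum>x\<in>?X. \<Sum>y\<in>?X. if int (?l y) - int (?l x) = \<tau> then psi k p m F ! ?l x * cnj (psi k p m G ! ?l y) else 0)"
    unfolding R ..
  also have "\<dots> = (\<Sum>x\<in>?X. \<Sum>y\<in>?X. if shift {1..\<Sum>i=1..k. m i} (coord_weight k p m) x y = \<tau>
      then root_of_unity q ^ F x * cnj (root_of_unity q ^ G y) else 0)"
    unfolding point_label_diff by (intro sum.cong refl) (simp add: nth)
  finally show ?thesis .
qed

text \<open>Secures at least one vector of restricted values; otherwise a condition quantified over
  them would be vacuous.\<close>

lemma nonempty_block_vecs:
  assumes "\<And>i. i \<in> {1..k} \<Longrightarrow> 0 < p i"
  shows "block_vecs k p e \<noteq> {}"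
proof
  assume "block_vecs k p e = {}"
  then have "(\<Prod>i=1..k. p i ^ e i) = 0" using card_block_vecs[of k p e] by (simp only: card.empty)
  moreover have "0 < (\<Prod>i=1..k. p i ^ e i)" using assms by (intro prod_pos) auto
  ultimately show False by (simp only: less_irrefl)
qed

subsection \<open>The codes of a family of paths\<close>

locale path_codes =
  fixes k q :: nat and p m n :: "nat \<Rightarrow> nat" and J :: "nat \<Rightarrow> nat set" and jl :: "nat \<Rightarrow> nat \<Rightarrow> nat"
    and \<pi> fij fij' gij :: "nat \<Rightarrow> nat \<Rightarrow> nat \<Rightarrow> nat" and fi hi :: "nat \<Rightarrow> nat \<Rightarrow> nat" and lam :: "nat \<Rightarrow> nat"
    and f :: "(nat \<Rightarrow> nat) \<Rightarrow> nat"
  assumes p: "i \<in> {1..k} \<Longrightarrow> 0 < p i" and q: "q = (\<Prod>i=1..k. p i)"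
    and n: "i \<in> {1..k} \<Longrightarrow> n i < m i"
    and J: "i \<in> {1..k} \<Longrightarrow> J i \<subseteq> block m i" and jl: "i \<in> {1..k} \<Longrightarrow> bij_betw (jl i) {1..n i} (J i)"
    and \<pi>: "i \<in> {1..k} \<Longrightarrow> c \<in> block_vecs k p n \<Longrightarrow>
        bij_betw (\<pi> i (label k p n c)) {1..m i - n i} (block m i - J i)"
    and f: "c \<in> block_vecs k p n \<Longrightarrow> x \<in> points k p m \<Longrightarrow>
      (\<And>i j. i \<in> {1..k} \<Longrightarrow> j \<in> {1..n i} \<Longrightarrow> x (jl i j) = c i j) \<Longrightarrow>
      f x = ((\<Sum>i=1..k.
          q div p i * (\<Sum>j=1..m i - n i - 1. fij i j (x (\<pi> i (label k p n c) j)) * fij' i j (x (\<pi> i (label k p n c) (j + 1))))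
          + (\<Sum>j=1..m i - n i. gij i j (x (\<pi> i (label k p n c) j))))
        + (\<Sum>i=1..k - 1. lam i * fi i (x (\<pi> i (label k p n c) (m i - n i))) * hi i (x (\<pi> (i + 1) (label k p n c) 1))))
        mod q"
begin

abbreviation N :: "nat \<Rightarrow> nat" where "N \<equiv> \<lambda>i. m i - n i"
abbreviation "ne \<equiv> \<lambda>i. n i + 1"
abbreviation "K \<equiv> \<Prod>i=1..k. p i ^ (n i + 1)"
abbreviation "L \<equiv> \<Prod>i=1..k. p i ^ m i"
abbreviation "\<omega> \<equiv> root_of_unity q"
abbreviation "diff \<equiv> shift {1..\<Sum>i=1..k. m i} (coord_weight k p m)"

definition restricted :: "(nat \<Rightarrow> nat) \<Rightarrow> nat \<Rightarrow> nat \<Rightarrow> nat" where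
  "restricted x = (\<lambda>i\<in>{1..k}. \<lambda>j\<in>{1..n i}. x (jl i j))"

text \<open>
  The vector multiplied by \<open>d\<close> in \<open>code_function\<close> is obtained from \<open>g i = 1\<close>, the one multiplied by \<open>t\<close>
  from \<open>g i = m i - n i\<close>.
\<close>

definition stat :: "(nat \<Rightarrow> nat) \<Rightarrow> (nat \<Rightarrow> nat) \<Rightarrow> nat \<Rightarrow> nat \<Rightarrow> nat" where
  "stat g x = (\<lambda>i\<in>{1..k}. \<lambda>j\<in>{1..n i + 1}.
     if j \<le> n i then x (jl i j) else x (\<pi> i (label k p n (restricted x)) (g i)))"

abbreviation "stat_first \<equiv> stat (\<lambda>_. 1)"
abbreviation "stat_last \<equiv> stat N"

lemma q_pos: "0 < q"
  unfolding q using p by (intro prod_pos) auto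

lemma N_pos: "i \<in> {1..k} \<Longrightarrow> 1 \<le> N i"
  using n by (simp add: Suc_leI)

lemma finite_points [simp]: "finite (points k p m)"
  using bij_betw_finite[OF point_label_bij_betw[where k = k and p = p and m = m, OF p]] by simp

lemma card_points: "card (points k p m) = L"
  using bij_betw_same_card[OF point_label_bij_betw[where k = k and p = p and m = m, OF p]] by simp

lemma points_less: "x \<in> points k p m \<Longrightarrow> i \<in> {1..k} \<Longrightarrow> s \<in> block m i \<Longrightarrow> x s < p i"
  unfolding points_def by blast

lemma jl_block: "i \<in> {1..k} \<Longrightarrow> j \<in> {1..n i} \<Longrightarrow> jl i j \<in> J i \<and> jl i j \<in> block m i"
  using bij_betwE[OF jl[of i]] J[of i] by blast

lemma \<pi>_block:
  "i \<in> {1..k} \<Longrightarrow> c \<in> block_vecs k p n \<Longrightarrow> j \<in> {1..N i} \<Longrightarrow>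
    \<pi> i (label k p n c) j \<in> block m i \<and> \<pi> i (label k p n c) j \<notin> J i"
  using bij_betwE[OF \<pi>[of i c]] by blast

lemma restricted_mem: "x \<in> points k p m \<Longrightarrow> restricted x \<in> block_vecs k p n"
proof -
  assume x: "x \<in> points k p m"
  have "x (jl i j) < p i" if "i \<in> {1..k}" "j \<in> {1..n i}" for i j
    using points_less[OF x that(1)] jl_block[OF that] by blast
  then show ?thesis unfolding restricted_def block_vecs_def by auto
qed

lemma stat_apply:
  "i \<in> {1..k} \<Longrightarrow> j \<in> {1..n i} \<Longrightarrow> stat g x i j = x (jl i j)"
  "i \<in> {1..k} \<Longrightarrow> stat g x i (n i + 1) = x (\<pi> i (label k p n (restricted x)) (g i))"
  unfolding stat_def by auto

lemma stat_mem:
  assumes x: "x \<in> points k p m" and g: "\<And>i. i \<in> {1..k} \<Longrightarrow> g i \<in> {1..N i}"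
  shows "stat g x \<in> block_vecs k p ne"
proof -
  have "x (jl i j) < p i" if "i \<in> {1..k}" "j \<in> {1..n i}" for i j
    using points_less[OF x that(1)] jl_block[OF that] by blast
  moreover have "x (\<pi> i (label k p n (restricted x)) (g i)) < p i" if "i \<in> {1..k}" for i
    using points_less[OF x that] \<pi>_block[OF that restricted_mem[OF x] g[OF that]] by blast
  ultimately show ?thesis unfolding stat_def block_vecs_def by auto
qed

lemma stat_first_mem: "x \<in> points k p m \<Longrightarrow> stat_first x \<in> block_vecs k p ne"
  using N_pos by (intro stat_mem) auto

lemma stat_last_mem: "x \<in> points k p m \<Longrightarrow> stat_last x \<in> block_vecs k p ne"
  using N_pos by (intro stat_mem) auto

text \<open>Assembles a value of \<open>stat_last\<close> from its two parts, the restricted values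
  \<open>c\<close> and the path ends given by \<open>\<alpha>\<close>.\<close>

definition extend :: "(nat \<Rightarrow> nat \<Rightarrow> nat) \<Rightarrow> (nat \<times> nat \<Rightarrow> nat) \<Rightarrow> nat \<Rightarrow> nat \<Rightarrow> nat" where
  "extend c \<alpha> = (\<lambda>i\<in>{1..k}. \<lambda>j\<in>{1..n i + 1}. if j \<le> n i then c i j else \<alpha> (i, N i))"

text \<open>Splitting \<open>d i j + t i j\<close> lets the restricted variables be paired once with
  \<open>d\<close> and once with \<open>t\<close>, so they occur in both statistics, next to the
  path starts and the path ends respectively.\<close>

lemma root_power_code_function:
  "\<omega> ^ code_function k p m n jl \<pi> f t d x =
    \<omega> ^ f x * (character k p ne d (stat_first x) * character k p ne t (stat_last x))"
proof -
  let ?c = "label k p n (restricted x)"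
  define E where "E i = (\<Sum>j=1..n i. (d i j + t i j) * x (jl i j))
      + d i (n i + 1) * x (\<pi> i ?c 1) + t i (n i + 1) * x (\<pi> i ?c (N i))" for i
  have c: "label k p n (\<lambda>i j. x (jl i j)) = ?c" by (rule label_cong) (simp add: restricted_def)
  have "\<omega> ^ code_function k p m n jl \<pi> f t d x = \<omega> ^ (f x + (\<Sum>i=1..k. q div p i * E i))"
    unfolding code_function_def Let_def q[symmetric] c E_def root_of_unity_power_mod[OF q_pos] ..
  also have "\<dots> = \<omega> ^ f x * (\<Prod>i=1..k. \<omega> ^ (q div p i * E i))"
    by (simp add: power_add power_sum)
  also have "(\<Prod>i=1..k. \<omega> ^ (q div p i * E i)) = (\<Prod>i=1..k. root_of_unity (p i) ^ E i)"
    using q_pos by (intro prod.cong refl root_of_unity_power_dvd) (auto simp: q)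
  also have "\<dots> = (\<Prod>i=1..k. (\<Prod>j=1..n i + 1. root_of_unity (p i) ^ (d i j * stat_first x i j)) *
      (\<Prod>j=1..n i + 1. root_of_unity (p i) ^ (t i j * stat_last x i j)))"
  proof (rule prod.cong[OF refl])
    fix i assume i: "i \<in> {1..k}"
    have s: "(\<Sum>j=1..n i + 1. v i j * stat g x i j) = (\<Sum>j=1..n i. v i j * x (jl i j)) + v i (n i + 1) * x (\<pi> i ?c (g i))"
      for v :: "nat \<Rightarrow> nat \<Rightarrow> nat" and g
      using stat_apply[OF i] by simp
    have "E i = (\<Sum>j=1..n i + 1. d i j * stat_first x i j) + (\<Sum>j=1..n i + 1. t i j * stat_last x i j)"
      unfolding s E_def by (simp add: sum.distrib distrib_right)
    then show "root_of_unity (p i) ^ E i = (\<Prod>j=1..n i + 1. root_of_unity (p i) ^ (d i j * stat_first x i j)) *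
      (\<Prod>j=1..n i + 1. root_of_unity (p i) ^ (t i j * stat_last x i j))"
      by (simp only: power_add power_sum)
  qed
  finally show ?thesis unfolding character_def prod.distrib .
qed

section \<open>The pairs of points that survive summation over the sequences of a code\<close>

definition matched_pairs :: "int \<Rightarrow> ((nat \<Rightarrow> nat) \<times> (nat \<Rightarrow> nat)) set" where
  "matched_pairs \<tau> = {(x, y) \<in> points k p m \<times> points k p m. diff x y = \<tau> \<and> stat_first x = stat_first y}"

lemma finite_matched_pairs [simp]: "finite (matched_pairs \<tau>)"
  by (rule finite_subset[of _ "points k p m \<times> points k p m"]) (auto simp: matched_pairs_def)

definition pair_weight :: "(nat \<Rightarrow> nat) \<times> (nat \<Rightarrow> nat) \<Rightarrow> complex" where
  "pair_weight z = \<omega> ^ f (fst z) * cnj (\<omega> ^ f (snd z))"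

lemma sum_unlabel: "(\<Sum>l<K. h (unlabel k p ne l)) = (\<Sum>d\<in>block_vecs k p ne. h d)"
proof -
  note bij = label_bij_betw[where k = k and p = p and e = ne, OF p]
  have "unlabel k p ne (label k p ne d) = d" if "d \<in> block_vecs k p ne" for d
    unfolding unlabel_def using the_inv_into_f_f[OF bij_betw_imp_inj_on[OF bij] that] .
  then show ?thesis using sum.reindex_bij_betw[OF bij, of "\<lambda>l. h (unlabel k p ne l)"] by simp
qed

lemma unlabel_bij_betw: "bij_betw (unlabel k p ne) {..<K} (block_vecs k p ne)"
  unfolding unlabel_def by (rule bij_betw_the_inv_into[OF label_bij_betw[OF p]])

text \<open>The index \<open>d\<close> enters the product of two phases only through the characters
  at \<open>stat_first x\<close> and \<open>stat_first y\<close>; their orthogonality yields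
  \<open>K\<close> for equal statistics and 0 otherwise.\<close>

lemma code_correlation_codes:
  assumes "r < K" "s < K" and \<tau>: "\<bar>\<tau>\<bar> < int L"
  shows "code_correlation (codes k p m n jl \<pi> f ! r) (codes k p m n jl \<pi> f ! s) \<tau> =
    of_nat K * (\<Sum>z\<in>matched_pairs \<tau>. pair_weight z *
      (character k p ne (unlabel k p ne r) (stat_last (fst z)) *
       cnj (character k p ne (unlabel k p ne s) (stat_last (snd z)))))"
proof -
  let ?t = "unlabel k p ne r" and ?t' = "unlabel k p ne s" and ?X = "points k p m" and ?B = "block_vecs k p ne"
  let ?F = "code_function k p m n jl \<pi> f" and ?c = "character k p ne"
  let ?G = "\<lambda>x y. pair_weight (x, y) * (?c ?t (stat_last x) * cnj (?c ?t' (stat_last y)))"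
  have sub: "matched_pairs \<tau> \<subseteq> ?X \<times> ?X" by (auto simp: matched_pairs_def)
  have cp: "correlation (psi k p m F) (psi k p m G) \<tau> =
    (\<Sum>x\<in>?X. \<Sum>y\<in>?X. if diff x y = \<tau> then \<omega> ^ F x * cnj (\<omega> ^ G y) else 0)" for F G
    by (rule correlation_psi[OF p q \<tau>])
  have "code_correlation (codes k p m n jl \<pi> f ! r) (codes k p m n jl \<pi> f ! s) \<tau> =
    (\<Sum>l<K. correlation (psi k p m (?F ?t (unlabel k p ne l))) (psi k p m (?F ?t' (unlabel k p ne l))) \<tau>)"
    unfolding code_correlation_def codes_def code_def using assms by simp
  also have "\<dots> = (\<Sum>d\<in>?B. correlation (psi k p m (?F ?t d)) (psi k p m (?F ?t' d)) \<tau>)"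
    by (rule sum_unlabel)
  also have "\<dots> = (\<Sum>d\<in>?B. \<Sum>x\<in>?X. \<Sum>y\<in>?X. if diff x y = \<tau> then
      ?G x y * (?c d (stat_first x) * cnj (?c d (stat_first y))) else 0)"
    unfolding cp root_power_code_function by (intro sum.cong refl) (simp add: pair_weight_def mult_ac)
  also have "\<dots> = (\<Sum>x\<in>?X. \<Sum>d\<in>?B. \<Sum>y\<in>?X. if diff x y = \<tau> then
      ?G x y * (?c d (stat_first x) * cnj (?c d (stat_first y))) else 0)"
    by (rule sum.swap)
  also have "\<dots> = (\<Sum>x\<in>?X. \<Sum>y\<in>?X. \<Sum>d\<in>?B. if diff x y = \<tau> then
      ?G x y * (?c d (stat_first x) * cnj (?c d (stat_first y))) else 0)"
    by (intro sum.cong refl sum.swap)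
  also have "\<dots> = (\<Sum>x\<in>?X. \<Sum>y\<in>?X. if diff x y = \<tau> \<and> stat_first x = stat_first y then of_nat K * ?G x y else 0)"
  proof (intro sum.cong refl)
    fix x y assume xy: "x \<in> ?X" "y \<in> ?X"
    note mem = stat_first_mem[OF xy(1)] stat_first_mem[OF xy(2)]
    have "(\<forall>i\<in>{1..k}. \<forall>j\<in>{1..n i + 1}. stat_first x i j = stat_first y i j) \<longleftrightarrow> stat_first x = stat_first y"
      using block_vecs_eqI[OF mem] by auto
    moreover have "(\<Sum>d\<in>?B. ?c d (stat_first x) * cnj (?c d (stat_first y))) =
      (if \<forall>i\<in>{1..k}. \<forall>j\<in>{1..n i + 1}. stat_first x i j = stat_first y i j then of_nat K else 0)"
      by (rule sum_character) (use p block_vecs_less mem in auto)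
    ultimately have S: "(\<Sum>d\<in>?B. ?c d (stat_first x) * cnj (?c d (stat_first y))) =
      (if stat_first x = stat_first y then of_nat K else 0)" by (simp only:)
    have ifs: "(\<Sum>d\<in>?B. if A then g * h d else 0) = (if A \<and> e then C * g else 0)"
      if "(\<Sum>d\<in>?B. h d) = (if e then C else 0)" for A e and g C :: complex and h
      by (cases A) (use that in \<open>simp_all add: mult.commute flip: sum_distrib_left\<close>)
    show "(\<Sum>d\<in>?B. if diff x y = \<tau> then ?G x y * (?c d (stat_first x) * cnj (?c d (stat_first y))) else 0)
      = (if diff x y = \<tau> \<and> stat_first x = stat_first y then of_nat K * ?G x y else 0)"
      by (rule ifs[OF S])
  qed
  also have "\<dots> = (\<Sum>x\<in>?X. \<Sum>y\<in>?X. if (x, y) \<in> matched_pairs \<tau> then of_nat K * ?G x y else 0)"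
  proof (intro sum.cong refl)
    fix x y assume "x \<in> ?X" "y \<in> ?X"
    then have "diff x y = \<tau> \<and> stat_first x = stat_first y \<longleftrightarrow> (x, y) \<in> matched_pairs \<tau>"
      unfolding matched_pairs_def by blast
    then show "(if diff x y = \<tau> \<and> stat_first x = stat_first y then of_nat K * ?G x y else 0) =
      (if (x, y) \<in> matched_pairs \<tau> then of_nat K * ?G x y else 0)" by (simp only:)
  qed
  also have "\<dots> = (\<Sum>z\<in>?X \<times> ?X. if z \<in> matched_pairs \<tau> then of_nat K * ?G (fst z) (snd z) else 0)"
    unfolding sum.cartesian_product by (simp only: case_prod_unfold prod.collapse)
  also have "\<dots> = (\<Sum>z\<in>matched_pairs \<tau>. of_nat K * ?G (fst z) (snd z))"
    by (rule sum.mono_neutral_cong_right[OF _ sub]) simp_all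
  finally show ?thesis by (simp add: sum_distrib_left)
qed

lemma diff_eq_0_iff: "x \<in> points k p m \<Longrightarrow> y \<in> points k p m \<Longrightarrow> diff x y = 0 \<longleftrightarrow> x = y"
  unfolding point_label_diff[symmetric]
  using inj_on_eq_iff[OF bij_betw_imp_inj_on[OF point_label_bij_betw[where k = k and p = p and m = m, OF p]], of x y]
  by auto

lemma abs_diff_less: "x \<in> points k p m \<Longrightarrow> y \<in> points k p m \<Longrightarrow> \<bar>diff x y\<bar> < int L"
proof -
  assume "x \<in> points k p m" "y \<in> points k p m"
  then have "point_label k p m x < L" "point_label k p m y < L"
    using bij_betwE[OF point_label_bij_betw[where k = k and p = p and m = m, OF p]] by blast+
  then show ?thesis unfolding point_label_diff[symmetric] by linarith
qed

subsection \<open>Fibres over the restricted variables\<close>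

definition fibre :: "(nat \<Rightarrow> nat \<Rightarrow> nat) \<Rightarrow> (nat \<Rightarrow> nat) set" where
  "fibre c = {x \<in> points k p m. restricted x = c}"

abbreviation "P \<equiv> \<lambda>s::nat \<times> nat. p (fst s)"

text \<open>On a fibre the label \<open>c\<close>, hence each path, is constant. Positions along the
  paths then replace the coordinates, and their index set is the same for all
  \<open>c\<close>.\<close>

definition place :: "(nat \<Rightarrow> nat \<Rightarrow> nat) \<Rightarrow> nat \<times> nat \<Rightarrow> nat" where
  "place c s = \<pi> (fst s) (label k p n c) (snd s)"

definition lift :: "(nat \<Rightarrow> nat \<Rightarrow> nat) \<Rightarrow> (nat \<Rightarrow> nat) \<Rightarrow> nat \<times> nat \<Rightarrow> nat" where
  "lift c x = (\<lambda>s\<in>positions k N. x (place c s))"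

lemma fibreD: "x \<in> fibre c \<Longrightarrow> x \<in> points k p m" "x \<in> fibre c \<Longrightarrow> restricted x = c"
  "x \<in> fibre c \<Longrightarrow> i \<in> {1..k} \<Longrightarrow> j \<in> {1..n i} \<Longrightarrow> x (jl i j) = c i j"
  unfolding fibre_def restricted_def by auto

lemma fibre_base: "x \<in> fibre c \<Longrightarrow> c \<in> block_vecs k p n"
  using restricted_mem fibreD(1,2) by metis

lemma place_block: "c \<in> block_vecs k p n \<Longrightarrow> s \<in> positions k N \<Longrightarrow> place c s \<in> block m (fst s) \<and> place c s \<notin> J (fst s)"
  unfolding place_def positions_def using \<pi>_block by auto

lemma inj_on_place:
  assumes c: "c \<in> block_vecs k p n"
  shows "inj_on (place c) (positions k N)"
proof (rule inj_onI)
  fix s s' assume s: "s \<in> positions k N" "s' \<in> positions k N" "place c s = place c s'"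
  have i: "fst s \<in> {1..k}" "fst s' \<in> {1..k}" "snd s \<in> {1..N (fst s)}" "snd s' \<in> {1..N (fst s')}"
    using s unfolding positions_def by auto
  have "place c s \<in> block m (fst s)" "place c s \<in> block m (fst s')"
    using place_block[OF c s(1)] place_block[OF c s(2)] s(3) by auto
  then have e: "fst s = fst s'" using block_disjoint[of "fst s" "fst s'"] i by simp
  then have "snd s = snd s'"
    using s(3) i bij_betw_imp_inj_on[OF \<pi>[OF i(2) c]] unfolding place_def inj_on_def by simp
  with e show "s = s'" by (simp add: prod_eq_iff)
qed

lemma coordinate_cases [consumes 2, case_names restricted free]:
  assumes c: "c \<in> block_vecs k p n" and s: "s \<in> {1..\<Sum>i=1..k. m i}"
  obtains (restricted) i j where "i \<in> {1..k}" "j \<in> {1..n i}" "s = jl i j"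
    | (free) r where "r \<in> positions k N" "s = place c r"
proof -
  obtain i where i: "i \<in> {1..k}" "s \<in> block m i" using s unfolding UN_block[symmetric] by blast
  show ?thesis
  proof (cases "s \<in> J i")
    case True
    then have "s \<in> jl i ` {1..n i}" using bij_betw_imp_surj_on[OF jl[OF i(1)]] by simp
    then show ?thesis using restricted[OF i(1)] by blast
  next
    case False
    then have "s \<in> \<pi> i (label k p n c) ` {1..N i}" using bij_betw_imp_surj_on[OF \<pi>[OF i(1) c]] i(2) by simp
    then obtain j where "j \<in> {1..N i}" "s = \<pi> i (label k p n c) j" by (elim imageE)
    then show ?thesis using free[of "(i, j)"] i(1) by (simp add: positions_def place_def)
  qed
qed

lemma lift_bij_betw:
  assumes c: "c \<in> block_vecs k p n"
  shows "bij_betw (lift c) (fibre c) (assigns (positions k N) P)"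
  unfolding bij_betw_def
proof
  show "inj_on (lift c) (fibre c)"
  proof (rule inj_onI)
    fix x y assume x: "x \<in> fibre c" and y: "y \<in> fibre c" and e: "lift c x = lift c y"
    show "x = y"
    proof (rule extensionalityI[where A = "{1..\<Sum>i=1..k. m i}"])
      fix s assume "s \<in> {1..\<Sum>i=1..k. m i}"
      with c show "x s = y s"
      proof (cases rule: coordinate_cases)
        case (restricted i j)
        then show ?thesis using fibreD(3)[OF x] fibreD(3)[OF y] by simp
      next
        case (free r)
        then show ?thesis using fun_cong[OF e, of r] unfolding lift_def by simp
      qed
    qed (use fibreD(1)[OF x] fibreD(1)[OF y] in \<open>auto simp: points_def\<close>)
  qed
  show "lift c ` fibre c = assigns (positions k N) P"
  proof (intro equalityI subsetI)
    fix z assume "z \<in> lift c ` fibre c"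
    then obtain x where x: "x \<in> fibre c" "z = lift c x" by blast
    have "x (place c s) < P s" if "s \<in> positions k N" for s
      using points_less[OF fibreD(1)[OF x(1)], of "fst s"] place_block[OF c that] that by (auto simp: positions_def)
    then show "z \<in> assigns (positions k N) P" unfolding x(2) lift_def assigns_def by auto
  next
    fix z assume z: "z \<in> assigns (positions k N) P"
    let ?M = "{1..\<Sum>i=1..k. m i}"
    \<comment> \<open>The inverse of \<open>lift c\<close>: a coordinate in the restricted set of
      its own block takes its value from \<open>c\<close>, any other from \<open>z\<close> at its
      position on a path.\<close>
    define x where "x = (\<lambda>s\<in>?M. let i = fst (coord k m s) in
      if s \<in> J i then c i (the_inv_into {1..n i} (jl i) s) else z (the_inv_into (positions k N) (place c) s))"
    have blk: "s \<in> ?M \<and> fst (coord k m s) = i" if i: "i \<in> {1..k}" and s: "s \<in> block m i" for i s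
    proof -
      obtain j where "j \<in> {1..m i}" "s = offset m i + j" using s unfolding block_eq_image by (elim imageE)
      then show ?thesis using coord_offset[OF i] offset_in_range[OF i] by simp
    qed
    have x1: "x (jl i j) = c i j" if "i \<in> {1..k}" "j \<in> {1..n i}" for i j
      unfolding x_def using blk[OF that(1)] jl_block[OF that] the_inv_into_f_f[OF bij_betw_imp_inj_on[OF jl[OF that(1)]] that(2)]
      by (simp add: Let_def)
    have x2: "x (place c s) = z s" if "s \<in> positions k N" for s
    proof -
      have "fst s \<in> {1..k}" using that unfolding positions_def by auto
      then show ?thesis
        unfolding x_def using blk place_block[OF c that] the_inv_into_f_f[OF inj_on_place[OF c] that] by (simp add: Let_def)
    qed
    have "x \<in> points k p m" unfolding points_def
    proof (intro CollectI conjI ballI)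
      show "x \<in> extensional ?M" unfolding x_def by simp
      fix i s assume i: "i \<in> {1..k}" and s: "s \<in> block m i"
      from blk[OF i s] have "s \<in> ?M" by blast
      with c show "x s < p i"
      proof (cases rule: coordinate_cases)
        case (restricted i' j)
        then have "i' = i" using block_disjoint[of i' i s] jl_block i s by auto
        then show ?thesis using x1 block_vecs_less[OF c] restricted by simp
      next
        case (free r)
        then have "fst r \<in> {1..k}" unfolding positions_def by auto
        then have "fst r = i" using block_disjoint[of "fst r" i s] place_block[OF c free(1)] free(2) i s by auto
        then show ?thesis using x2[OF free(1)] assigns_less[OF z free(1)] free(2) by simp
      qed
    qed
    moreover have "restricted x = c"
      by (rule block_vecs_eqI[OF restricted_mem[OF calculation] c]) (simp add: restricted_def x1)
    ultimately have "x \<in> fibre c" unfolding fibre_def by simp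
    moreover have "lift c x = z"
      by (rule extensionalityI[where A = "positions k N"]) (use z x2 in \<open>auto simp: lift_def assigns_def PiE_iff\<close>)
    ultimately show "z \<in> lift c ` fibre c" by blast
  qed
qed

text \<open>Two points of a fibre agree in all restricted coordinates, so only the coordinates on
  the paths contribute to the difference.\<close>

lemma diff_lift:
  assumes x: "x \<in> fibre c" and y: "y \<in> fibre c"
  shows "diff x y = shift (positions k N) (coord_weight k p m \<circ> place c) (lift c x) (lift c y)"
proof -
  note c = fibre_base[OF x]
  let ?h = "\<lambda>s. (int (y s) - int (x s)) * coord_weight k p m s"
  have "place c s \<in> {1..\<Sum>i=1..k. m i}" if "s \<in> positions k N" for s
    unfolding UN_block[symmetric] using place_block[OF c that] that by (auto simp: positions_def)
  then have sub: "place c ` positions k N \<subseteq> {1..\<Sum>i=1..k. m i}" by blast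
  have "diff x y = (\<Sum>s\<in>place c ` positions k N. ?h s)"
    unfolding shift_def
  proof (rule sum.mono_neutral_right[OF _ sub ballI])
    fix s assume s: "s \<in> {1..\<Sum>i=1..k. m i} - place c ` positions k N"
    then have "s \<in> {1..\<Sum>i=1..k. m i}" by blast
    with c show "?h s = 0"
    proof (cases rule: coordinate_cases)
      case (restricted i j)
      then show ?thesis using fibreD(3)[OF x] fibreD(3)[OF y] by simp
    next
      case (free r)
      then show ?thesis using s by blast
    qed
  qed simp
  also have "\<dots> = (\<Sum>s\<in>positions k N. ?h (place c s))"
    by (simp add: sum.reindex[OF inj_on_place[OF c]])
  also have "\<dots> = shift (positions k N) (coord_weight k p m \<circ> place c) (lift c x) (lift c y)"
    unfolding shift_def by (rule sum.cong) (auto simp: lift_def)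
  finally show ?thesis .
qed

text \<open>Shift zero means equal point labels, and these determine the point.\<close>

lemma dissociated_lift:
  assumes c: "c \<in> block_vecs k p n"
  shows "dissociated (positions k N) P (coord_weight k p m \<circ> place c)"
  unfolding dissociated_def
proof (intro ballI impI)
  fix u v assume "u \<in> assigns (positions k N) P" "v \<in> assigns (positions k N) P"
    and s: "shift (positions k N) (coord_weight k p m \<circ> place c) u v = 0"
  then obtain x y where xy: "x \<in> fibre c" "u = lift c x" "y \<in> fibre c" "v = lift c y"
    unfolding bij_betw_imp_surj_on[OF lift_bij_betw[OF c], symmetric] by blast
  then have "diff x y = 0" using s diff_lift by simp
  then show "u = v" using diff_eq_0_iff fibreD(1) xy by blast
qed

lemma lasts_subset: "lasts k N \<subseteq> positions k N"
  using N_pos unfolding lasts_def positions_def by auto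

text \<open>Prescribing \<open>stat_last\<close> fixes at once the fibre and, within it, the values
  at the ends of the paths.\<close>

lemma stat_last_eq_extend_iff:
  assumes c: "c \<in> block_vecs k p n" and x: "x \<in> points k p m"
  shows "stat_last x = extend c \<alpha> \<longleftrightarrow> x \<in> fibre c \<and> agree (lasts k N) (lift c x) \<alpha>"
proof
  assume e: "stat_last x = extend c \<alpha>"
  \<comment> \<open>The fibre must be identified before the ends, because the coordinate in which a
    path ends depends on it.\<close>
  have "restricted x = c"
  proof (rule block_vecs_eqI[OF restricted_mem[OF x] c])
    fix i j assume ij: "i \<in> {1..k}" "j \<in> {1..n i}"
    then have "x (jl i j) = extend c \<alpha> i j" using stat_apply(1)[OF ij, of N x] e by simp
    then show "restricted x i j = c i j" using ij unfolding restricted_def extend_def by simp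
  qed
  moreover have "lift c x (i, N i) = \<alpha> (i, N i)" if i: "i \<in> {1..k}" for i
  proof -
    have "x (\<pi> i (label k p n c) (N i)) = extend c \<alpha> i (n i + 1)"
      using stat_apply(2)[OF i, of N x] e calculation by simp
    then show ?thesis using i N_pos[OF i] unfolding lift_def place_def extend_def positions_def by simp
  qed
  ultimately show "x \<in> fibre c \<and> agree (lasts k N) (lift c x) \<alpha>"
    using x unfolding fibre_def agree_def lasts_def by auto
next
  assume *: "x \<in> fibre c \<and> agree (lasts k N) (lift c x) \<alpha>"
  have "x (\<pi> i (label k p n c) (N i)) = \<alpha> (i, N i)" if i: "i \<in> {1..k}" for i
  proof -
    have "lift c x (i, N i) = \<alpha> (i, N i)" using * i unfolding agree_def lasts_def by auto
    then show ?thesis using i N_pos[OF i] unfolding lift_def place_def positions_def by simp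
  qed
  moreover have xf: "x \<in> fibre c" using * by blast
  ultimately show "stat_last x = extend c \<alpha>"
    unfolding stat_def extend_def fibreD(2)[OF xf] by (intro restrict_ext) (simp add: fibreD(3)[OF xf])
qed

lemma stat_first_eq_iff:
  assumes x: "x \<in> fibre c" and y: "y \<in> fibre c"
  shows "stat_first x = stat_first y \<longleftrightarrow> agree (firsts k) (lift c x) (lift c y)"
proof -
  have l: "lift c z (i, 1) = z (\<pi> i (label k p n c) 1)" if "i \<in> {1..k}" for z i
    using that N_pos[OF that] unfolding lift_def place_def positions_def by simp
  have ag: "agree (firsts k) (lift c x) (lift c y) \<longleftrightarrow> (\<forall>i\<in>{1..k}. x (\<pi> i (label k p n c) 1) = y (\<pi> i (label k p n c) 1))"
    unfolding agree_def firsts_def using l by simp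
  show ?thesis
  proof
    assume e: "stat_first x = stat_first y"
    show "agree (firsts k) (lift c x) (lift c y)" unfolding ag
    proof
      fix i assume "i \<in> {1..k}"
      then show "x (\<pi> i (label k p n c) 1) = y (\<pi> i (label k p n c) 1)"
        using stat_apply(2)[of i "\<lambda>_. 1" x] stat_apply(2)[of i "\<lambda>_. 1" y] e fibreD(2)[OF x] fibreD(2)[OF y] by simp
    qed
  next
    assume "agree (firsts k) (lift c x) (lift c y)"
    then show "stat_first x = stat_first y"
      unfolding ag stat_def fibreD(2)[OF x] fibreD(2)[OF y]
      by (intro restrict_ext) (simp add: fibreD(3)[OF x] fibreD(3)[OF y])
  qed
qed

section \<open>The phase of the function as a product along the paths\<close>

definition start_phase :: "nat \<Rightarrow> nat \<Rightarrow> nat \<Rightarrow> complex" where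
  "start_phase i a b =
    \<omega> ^ (gij i 1 b + (if 2 \<le> i then lam (i - 1) * fi (i - 1) a * hi (i - 1) b else 0))"

text \<open>Each \<open>gij\<close> is charged once: the one with index 1 to the start of the path,
  the one with index \<open>j + 1\<close> to the edge entering that variable, where it is a factor
  of a column. The coupling with the previous block belongs to \<open>start_phase\<close>.\<close>

definition edge_matrix :: "nat \<Rightarrow> nat \<Rightarrow> nat \<Rightarrow> nat \<Rightarrow> complex" where
  "edge_matrix i j u v = \<omega> ^ (q div p i * (fij i j u * fij' i j v) + gij i (j + 1) v)"

abbreviation "weight \<equiv> chain_weight k N start_phase edge_matrix"

lemma edge_matrix_eq:
  assumes "i \<in> {1..k}"
  shows "edge_matrix i j = (\<lambda>u v. root_of_unity (p i) ^ (fij i j u * fij' i j v) * \<omega> ^ gij i (j + 1) v)"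
proof -
  have "p i dvd q" unfolding q using assms by (intro dvd_prodI) auto
  then show ?thesis unfolding edge_matrix_def power_add by (simp only: root_of_unity_power_dvd[OF q_pos])
qed

lemma column_orth_edge_matrix:
  assumes "i \<in> {1..k}"
  shows "column_orth (p i) (edge_matrix i j) \<longleftrightarrow> permutes_mod (p i) (fij i j) \<and> permutes_mod (p i) (fij' i j)"
proof -
  have "norm (\<omega> ^ gij i (j + 1) v) = 1" for v by (simp add: norm_power)
  from column_orth_weighted[where \<gamma> = "\<lambda>v. \<omega> ^ gij i (j + 1) v", OF this]
  show ?thesis unfolding edge_matrix_eq[OF assms] by (simp only: column_orth_exponential_iff[OF p[OF assms]])
qed

lemma row_orth_edge_matrix:
  assumes i: "i \<in> {1..k}" and "column_orth (p i) (edge_matrix i j)"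
  shows "row_orth (p i) (edge_matrix i j)"
proof -
  have "norm (\<omega> ^ gij i (j + 1) v) = 1" for v by (simp add: norm_power)
  from row_orth_weighted[where \<gamma> = "\<lambda>v. \<omega> ^ gij i (j + 1) v", OF this]
  show ?thesis unfolding edge_matrix_eq[OF i]
    using assms(2) row_orth_exponential[OF p[OF i]] by (simp only: column_orth_edge_matrix[OF i])
qed

text \<open>The definition of \<open>f\<close> turns into a product over the blocks once the
  coupling terms and the functions \<open>gij\<close> are distributed over starts and edges.\<close>

lemma weight_lift:
  assumes x: "x \<in> fibre c"
  shows "\<omega> ^ f x = weight (lift c x)"
proof -
  note c = fibre_base[OF x]
  define \<sigma> where "\<sigma> i = \<pi> i (label k p n c)" for i
  have lift: "lift c x (i, j) = x (\<sigma> i j)" if "i \<in> {1..k}" "j \<in> {1..N i}" for i j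
    using that unfolding lift_def place_def positions_def \<sigma>_def by simp
  define C where "C i = lam i * fi i (x (\<sigma> i (N i))) * hi i (x (\<sigma> (i + 1) 1))" for i
  define A where "A i = q div p i * (\<Sum>j=1..N i - 1. fij i j (x (\<sigma> i j)) * fij' i j (x (\<sigma> i (j + 1))))
      + (\<Sum>j=1..N i. gij i j (x (\<sigma> i j)))" for i
  \<comment> \<open>The term coupling blocks \<open>i - 1\<close> and \<open>i\<close> is moved to
    index \<open>i\<close>, with 0 for the first block.\<close>
  define B where "B i = (if 2 \<le> i then C (i - 1) else 0)" for i
  have "(\<Sum>i=1..Suc r. B i) = (\<Sum>i=1..r. C i)" for r
    by (induction r) (auto simp: B_def)
  then have B: "(\<Sum>i=1..k. B i) = (\<Sum>i=1..k - 1. C i)" by (cases k) auto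
  have "f x = ((\<Sum>i=1..k. A i) + (\<Sum>i=1..k - 1. C i)) mod q"
    unfolding A_def C_def \<sigma>_def by (rule f[OF c fibreD(1)[OF x]]) (rule fibreD(3)[OF x])
  then have "\<omega> ^ f x = \<omega> ^ ((\<Sum>i=1..k. A i) + (\<Sum>i=1..k - 1. C i))"
    by (simp only: root_of_unity_power_mod[OF q_pos])
  also have "\<dots> = (\<Prod>i=1..k. \<omega> ^ (A i + B i))"
    unfolding B[symmetric] by (simp add: power_add power_sum prod.distrib)
  also have "\<dots> = weight (lift c x)" unfolding chain_weight_def
  proof (rule prod.cong[OF refl])
    fix i assume i: "i \<in> {1..k}"
    obtain r where r: "N i = Suc r" using N_pos[OF i] by (cases "N i") auto
    have prev: "lift c x (i - 1, N (i - 1)) = x (\<sigma> (i - 1) (N (i - 1)))" if "2 \<le> i"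
    proof -
      have "i - 1 \<in> {1..k}" using that i by auto
      from lift[OF this] N_pos[OF this] show ?thesis by simp
    qed
    have first: "lift c x (i, 1) = x (\<sigma> i 1)" by (rule lift) (use i N_pos in auto)
    have start: "start_phase i (lift c x (i - 1, N (i - 1))) (lift c x (i, 1)) = \<omega> ^ (gij i 1 (x (\<sigma> i 1)) + B i)"
      unfolding start_phase_def first B_def C_def using prev by simp
    have "(\<Prod>j=1..<N i. edge_matrix i j (lift c x (i, j)) (lift c x (i, j + 1)))
      = (\<Prod>j=1..<N i. \<omega> ^ (q div p i * (fij i j (x (\<sigma> i j)) * fij' i j (x (\<sigma> i (j + 1)))) + gij i (j + 1) (x (\<sigma> i (j + 1)))))"
      unfolding edge_matrix_def by (intro prod.cong refl) (use i in \<open>simp add: lift\<close>)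
    also have "\<dots> = \<omega> ^ (\<Sum>j=1..<N i. q div p i * (fij i j (x (\<sigma> i j)) * fij' i j (x (\<sigma> i (j + 1)))) + gij i (j + 1) (x (\<sigma> i (j + 1))))"
      by (rule power_sum[symmetric])
    finally have "path_weight N start_phase edge_matrix i (N i) (lift c x) = \<omega> ^ (gij i 1 (x (\<sigma> i 1)) + B i +
        (\<Sum>j=1..<N i. q div p i * (fij i j (x (\<sigma> i j)) * fij' i j (x (\<sigma> i (j + 1)))) + gij i (j + 1) (x (\<sigma> i (j + 1)))))"
      unfolding path_weight_def start by (simp only: power_add)
    moreover have "A i = gij i 1 (x (\<sigma> i 1)) +
        (\<Sum>j=1..<N i. q div p i * (fij i j (x (\<sigma> i j)) * fij' i j (x (\<sigma> i (j + 1)))) + gij i (j + 1) (x (\<sigma> i (j + 1))))"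
    proof -
      \<comment> \<open>The term with \<open>j = 1\<close> belongs to the start; the others are
        renumbered by the edges leading to them.\<close>
      have "(\<Sum>j=1..N i. gij i j (x (\<sigma> i j))) = gij i 1 (x (\<sigma> i 1)) + (\<Sum>j=1..<N i. gij i (j + 1) (x (\<sigma> i (j + 1))))"
        unfolding r by (simp add: sum.atLeast_Suc_atMost sum.shift_bounds_cl_Suc_ivl atLeastLessThanSuc_atLeastAtMost del: sum.cl_ivl_Suc)
      moreover have "{1..N i - 1} = {1..<N i}" using r by auto
      ultimately show ?thesis unfolding A_def by (simp add: sum.distrib sum_distrib_left)
    qed
    ultimately show "\<omega> ^ (A i + B i) = path_weight N start_phase edge_matrix i (N i) (lift c x)"
      by (simp add: add_ac)
  qed
  finally show ?thesis .
qed

text \<open>The bijection \<open>lift c\<close> translates each condition: equal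
  \<open>stat_first\<close> into agreement on \<open>firsts\<close>, prescribed
  \<open>stat_last\<close> into prescription on \<open>lasts\<close>, and the lag into the shift.
  Pairs outside the fibre satisfy neither side.\<close>

lemma sum_matched_pairs_eq_pair_corr:
  assumes c: "c \<in> block_vecs k p n"
  shows "(\<Sum>z | z \<in> matched_pairs \<tau> \<and> stat_last (fst z) = extend c \<alpha> \<and> stat_last (snd z) = extend c \<beta>. pair_weight z) =
    pair_corr (positions k N) P (coord_weight k p m \<circ> place c) (firsts k) (lasts k N) weight \<tau> \<alpha> \<beta>"
proof -
  let ?F = "fibre c" and ?l = "lift c"
  have finF: "finite ?F" by (rule finite_subset[OF _ finite_points]) (auto simp: fibre_def)
  have R: "(\<Sum>u\<in>assigns (positions k N) P. H u) = (\<Sum>x\<in>?F. H (?l x))" for H :: "(nat \<times> nat \<Rightarrow> nat) \<Rightarrow> complex"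
    using sum.reindex_bij_betw[OF lift_bij_betw[OF c], of H] by simp
  let ?ok = "\<lambda>x y. agree (firsts k) (?l x) (?l y) \<and> agree (lasts k N) (?l x) \<alpha> \<and> agree (lasts k N) (?l y) \<beta> \<and>
    shift (positions k N) (coord_weight k p m \<circ> place c) (?l x) (?l y) = \<tau>"
  have "pair_corr (positions k N) P (coord_weight k p m \<circ> place c) (firsts k) (lasts k N) weight \<tau> \<alpha> \<beta>
    = (\<Sum>x\<in>?F. \<Sum>y\<in>?F. if ?ok x y then weight (?l x) * cnj (weight (?l y)) else 0)"
    unfolding pair_corr_def R ..
  also have "\<dots> = (\<Sum>x\<in>?F. \<Sum>y\<in>?F. if ?ok x y then pair_weight (x, y) else 0)"
    by (intro sum.cong refl) (simp add: pair_weight_def weight_lift)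
  also have "\<dots> = (\<Sum>z\<in>?F \<times> ?F. if ?ok (fst z) (snd z) then pair_weight z else 0)"
    unfolding sum.cartesian_product by (rule sum.cong) auto
  also have "\<dots> = (\<Sum>z | z \<in> ?F \<times> ?F \<and> ?ok (fst z) (snd z). pair_weight z)"
    using finF by (simp add: sum.inter_filter)
  also have "{z. z \<in> ?F \<times> ?F \<and> ?ok (fst z) (snd z)} =
    {z. z \<in> matched_pairs \<tau> \<and> stat_last (fst z) = extend c \<alpha> \<and> stat_last (snd z) = extend c \<beta>}"
  proof (rule Collect_cong)
    fix z :: "(nat \<Rightarrow> nat) \<times> (nat \<Rightarrow> nat)"
    obtain x y where z: "z = (x, y)" by (cases z)
    show "z \<in> ?F \<times> ?F \<and> ?ok (fst z) (snd z) \<longleftrightarrow>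
      z \<in> matched_pairs \<tau> \<and> stat_last (fst z) = extend c \<alpha> \<and> stat_last (snd z) = extend c \<beta>"
    proof (cases "x \<in> ?F \<and> y \<in> ?F")
      case True
      then have "x \<in> points k p m" "y \<in> points k p m" using fibreD(1) by blast+
      with True show ?thesis
        unfolding z matched_pairs_def
        by (auto simp: stat_last_eq_extend_iff[OF c] stat_first_eq_iff[of x c y] diff_lift[of x c y] simp del: One_nat_def)
    next
      case False
      have "\<not> (z \<in> matched_pairs \<tau> \<and> stat_last (fst z) = extend c \<alpha> \<and> stat_last (snd z) = extend c \<beta>)"
      proof
        assume "z \<in> matched_pairs \<tau> \<and> stat_last (fst z) = extend c \<alpha> \<and> stat_last (snd z) = extend c \<beta>"
        then have "x \<in> points k p m" "y \<in> points k p m" "stat_last x = extend c \<alpha>" "stat_last y = extend c \<beta>"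
          unfolding z matched_pairs_def by auto
        then show False using False stat_last_eq_extend_iff[OF c] by blast
      qed
      then show ?thesis using False unfolding z by auto
    qed
  qed
  finally show ?thesis by (rule sym)
qed

lemma extend_mem:
  assumes c: "c \<in> block_vecs k p n" and \<alpha>: "\<And>i. i \<in> {1..k} \<Longrightarrow> \<alpha> (i, N i) < p i"
  shows "extend c \<alpha> \<in> block_vecs k p ne"
proof -
  have "extend c \<alpha> i j < p i" if "i \<in> {1..k}" "j \<in> {1..n i + 1}" for i j
    using that block_vecs_less[OF c] \<alpha> unfolding extend_def by auto
  then show ?thesis unfolding block_vecs_def extend_def by auto
qed

lemma extend_cases:
  assumes a: "a \<in> block_vecs k p ne"
  obtains c \<alpha> where "c \<in> block_vecs k p n" "a = extend c \<alpha>" "\<And>i. i \<in> {1..k} \<Longrightarrow> \<alpha> (i, N i) < p i"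
proof -
  define c where "c = (\<lambda>i\<in>{1..k}. \<lambda>j\<in>{1..n i}. a i j)"
  \<comment> \<open>Only the values at \<open>(i, N i)\<close> matter, so the step on the path is
    ignored.\<close>
  define \<alpha> where "\<alpha> s = a (fst s) (n (fst s) + 1)" for s :: "nat \<times> nat"
  have "a i j < p i" if "i \<in> {1..k}" "j \<in> {1..n i}" for i j
    using block_vecs_less[OF a that(1), of j] that(2) by simp
  then have c: "c \<in> block_vecs k p n" unfolding c_def block_vecs_def by auto
  have \<alpha>: "\<alpha> (i, N i) < p i" if "i \<in> {1..k}" for i
    using block_vecs_less[OF a that, of "n i + 1"] unfolding \<alpha>_def by simp
  from extend_mem[OF c \<alpha>] have "a = extend c \<alpha>"
  proof (rule block_vecs_eqI[OF a])
    fix i j assume "i \<in> {1..k}" "j \<in> {1..n i + 1}"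
    then show "a i j = extend c \<alpha> i j"
      by (cases "j \<le> n i") (auto simp: extend_def c_def \<alpha>_def le_Suc_eq)
  qed
  with c \<alpha> show ?thesis using that by blast
qed

text \<open>\<open>stat_last\<close> is equidistributed: the count does not depend on
  \<open>a\<close>. This makes the family correct at lag zero.\<close>

lemma card_stat_last:
  assumes a: "a \<in> block_vecs k p ne"
  shows "card {x \<in> points k p m. stat_last x = a} = (\<Prod>s\<in>positions k N - lasts k N. P s)"
proof -
  from a obtain c \<alpha> where c: "c \<in> block_vecs k p n" and e: "a = extend c \<alpha>"
    and \<alpha>: "\<And>i. i \<in> {1..k} \<Longrightarrow> \<alpha> (i, N i) < p i" by (rule extend_cases) blast
  let ?A = "{u \<in> assigns (positions k N) P. agree (lasts k N) u \<alpha>}"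
  have eq: "{x \<in> points k p m. stat_last x = a} = {x \<in> fibre c. agree (lasts k N) (lift c x) \<alpha>}"
    unfolding e using stat_last_eq_extend_iff[OF c] fibreD(1) by blast
  have "lift c ` {x \<in> fibre c. agree (lasts k N) (lift c x) \<alpha>} = ?A"
    unfolding bij_betw_imp_surj_on[OF lift_bij_betw[OF c], symmetric] by blast
  moreover have "inj_on (lift c) {x \<in> fibre c. agree (lasts k N) (lift c x) \<alpha>}"
    by (rule inj_on_subset[OF bij_betw_imp_inj_on[OF lift_bij_betw[OF c]]]) blast
  ultimately have "card {x \<in> points k p m. stat_last x = a} = card ?A"
    unfolding eq by (simp only: card_image[symmetric])
  also have "\<dots> = (\<Prod>s\<in>positions k N - lasts k N. P s)"
    by (rule card_agree[OF finite_positions lasts_subset]) (use \<alpha> in \<open>auto simp: lasts_def\<close>)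
  finally show ?thesis .
qed

section \<open>Correlations of the family at zero and nonzero lags\<close>

definition total_corr where
  "total_corr t t' \<tau> = (\<Sum>z\<in>matched_pairs \<tau>. pair_weight z *
      (character k p ne t (stat_last (fst z)) * cnj (character k p ne t' (stat_last (snd z)))))"

text \<open>At lag zero only \<open>x = y\<close> remains and the phases of \<open>f\<close> cancel.
  Equidistribution of \<open>stat_last\<close> leaves the orthogonality of the characters
  \<open>t\<close> and \<open>t'\<close>.\<close>

lemma total_corr_0:
  assumes t: "t \<in> block_vecs k p ne" "t' \<in> block_vecs k p ne"
  shows "total_corr t t' 0 = (if t = t' then of_nat L else 0)"
proof -
  let ?c = "character k p ne" and ?X = "points k p m" and ?B = "block_vecs k p ne"
  define C where "C = (\<Prod>s\<in>positions k N - lasts k N. P s)"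
  have group: "(\<Sum>x\<in>?X. h (stat_last x)) = of_nat C * (\<Sum>a\<in>?B. h a)" for h :: "_ \<Rightarrow> complex"
  proof -
    have "(\<Sum>x\<in>?X. h (stat_last x)) = (\<Sum>a\<in>?B. \<Sum>x | x \<in> ?X \<and> stat_last x = a. h (stat_last x))"
      by (rule sum.group[symmetric]) (use stat_last_mem in auto)
    also have "\<dots> = (\<Sum>a\<in>?B. of_nat C * h a)"
      by (rule sum.cong) (simp_all add: card_stat_last C_def)
    finally show ?thesis by (simp add: sum_distrib_left)
  qed
  \<comment> \<open>Testing the grouping with the constant function 1 relates the common fibre size
    \<open>C\<close> of \<open>stat_last\<close> to \<open>L\<close>.\<close>
  have L: "of_nat L = (of_nat C * of_nat K :: complex)"
    using group[of "\<lambda>_. 1"] by (simp only: sum_constant card_points card_block_vecs mult_1_right)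
  have "matched_pairs 0 = (\<lambda>x. (x, x)) ` ?X"
    unfolding matched_pairs_def using diff_eq_0_iff by auto
  then have "total_corr t t' 0 = (\<Sum>x\<in>?X. pair_weight (x, x) * (?c t (stat_last x) * cnj (?c t' (stat_last x))))"
    unfolding total_corr_def by (simp add: sum.reindex inj_on_def)
  also have "\<dots> = (\<Sum>x\<in>?X. ?c (stat_last x) t * cnj (?c (stat_last x) t'))"
    by (intro sum.cong refl)
      (simp add: pair_weight_def mult_cnj_eq_1 norm_power character_commute[of _ _ _ t] character_commute[of _ _ _ t'] del: complex_cnj_power)
  also have "\<dots> = of_nat C * (\<Sum>a\<in>?B. ?c a t * cnj (?c a t'))" by (rule group)
  also have "(\<Sum>a\<in>?B. ?c a t * cnj (?c a t')) =
    (if \<forall>i\<in>{1..k}. \<forall>j\<in>{1..n i + 1}. t i j = t' i j then of_nat K else 0)"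
    by (rule sum_character) (use p block_vecs_less t in auto)
  also have "(\<forall>i\<in>{1..k}. \<forall>j\<in>{1..n i + 1}. t i j = t' i j) \<longleftrightarrow> t = t'"
    using block_vecs_eqI[OF t] by auto
  finally show ?thesis using L by auto
qed

text \<open>The values at lag zero are automatically the required ones, so the property is a
  statement about nonzero lags alone.\<close>

lemma is_CCC_iff_total_corr:
  "is_CCC K L (codes k p m n jl \<pi> f) \<longleftrightarrow>
    (\<forall>\<tau>. \<tau> \<noteq> 0 \<longrightarrow> (\<forall>t\<in>block_vecs k p ne. \<forall>t'\<in>block_vecs k p ne. total_corr t t' \<tau> = 0))"
proof -
  let ?B = "block_vecs k p ne" and ?u = "unlabel k p ne"
  note bij = unlabel_bij_betw
  have K: "0 < K" using p by (intro prod_pos) auto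
  have corr: "code_correlation (codes k p m n jl \<pi> f ! r) (codes k p m n jl \<pi> f ! s) \<tau> = of_nat K * total_corr (?u r) (?u s) \<tau>"
    if "r < K" "s < K" "\<bar>\<tau>\<bar> < int L" for r s \<tau>
    using code_correlation_codes[OF that] unfolding total_corr_def .
  have u: "?u r \<in> ?B" if "r < K" for r using bij_betwE[OF bij] that by blast
  have u_eq: "?u r = ?u s \<longleftrightarrow> r = s" if "r < K" "s < K" for r s
    using inj_on_eq_iff[OF bij_betw_imp_inj_on[OF bij]] that by simp
  have "total_corr t t' \<tau> = 0" if "\<not> \<bar>\<tau>\<bar> < int L" for t t' \<tau>
  proof -
    have "matched_pairs \<tau> = {}" using that abs_diff_less unfolding matched_pairs_def by auto
    then show ?thesis unfolding total_corr_def by simp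
  qed
  then have "(\<forall>\<tau>. \<tau> \<noteq> 0 \<longrightarrow> (\<forall>t\<in>?B. \<forall>t'\<in>?B. total_corr t t' \<tau> = 0)) \<longleftrightarrow>
    (\<forall>\<tau>. \<bar>\<tau>\<bar> < int L \<longrightarrow> \<tau> \<noteq> 0 \<longrightarrow> (\<forall>t\<in>?B. \<forall>t'\<in>?B. total_corr t t' \<tau> = 0))" by blast
  also have "\<dots> \<longleftrightarrow> (\<forall>r<K. \<forall>s<K. \<forall>\<tau>. \<bar>\<tau>\<bar> < int L \<longrightarrow> \<tau> \<noteq> 0 \<longrightarrow> total_corr (?u r) (?u s) \<tau> = 0)"
    unfolding bij_betw_imp_surj_on[OF bij, symmetric] by blast
  also have "\<dots> \<longleftrightarrow> (\<forall>r<K. \<forall>s<K. \<forall>\<tau>. \<bar>\<tau>\<bar> < int L \<longrightarrow>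
     code_correlation (codes k p m n jl \<pi> f ! r) (codes k p m n jl \<pi> f ! s) \<tau> = (if r = s \<and> \<tau> = 0 then of_nat (K * L) else 0))"
  proof -
    have "(\<tau> \<noteq> 0 \<longrightarrow> total_corr (?u r) (?u s) \<tau> = 0) \<longleftrightarrow>
      code_correlation (codes k p m n jl \<pi> f ! r) (codes k p m n jl \<pi> f ! s) \<tau> = (if r = s \<and> \<tau> = 0 then of_nat (K * L) else 0)"
      if rs: "r < K" "s < K" "\<bar>\<tau>\<bar> < int L" for r s \<tau>
    proof (cases "\<tau> = 0")
      case True
      have "of_nat K * total_corr (?u r) (?u s) 0 = (if r = s then of_nat (K * L) else 0)"
        unfolding total_corr_0[OF u[OF rs(1)] u[OF rs(2)]] u_eq[OF rs(1,2)] by simp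
      then show ?thesis unfolding corr[OF rs] using True by simp
    next
      case False
      have "(of_nat K :: complex) \<noteq> 0" using K by (simp only: of_nat_eq_0_iff)
      then have "of_nat K * total_corr (?u r) (?u s) \<tau> = 0 \<longleftrightarrow> total_corr (?u r) (?u s) \<tau> = 0" by (simp only: mult_eq_0_iff simp_thms)
      then show ?thesis unfolding corr[OF rs] using False by simp
    qed
    then show ?thesis by blast
  qed
  also have "\<dots> \<longleftrightarrow> is_CCC K L (codes k p m n jl \<pi> f)"
    unfolding is_CCC_def by (simp add: codes_def code_def psi_def)
  finally show ?thesis by blast
qed

text \<open>Fourier inversion in \<open>t\<close> and \<open>t'\<close> prescribes
  \<open>stat_last\<close> for both points. Splitting the two prescribed values into restricted
  parts and ends distributes the conditions over the fibres.\<close>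

lemma is_CCC_iff_vanishing:
  "is_CCC K L (codes k p m n jl \<pi> f) \<longleftrightarrow>
    (\<forall>c\<in>block_vecs k p n. vanishing (positions k N) P (coord_weight k p m \<circ> place c) (firsts k) (lasts k N) weight)"
proof -
  let ?B = "block_vecs k p ne"
  let ?R = "\<lambda>\<tau> a b. \<Sum>z | z \<in> matched_pairs \<tau> \<and> stat_last (fst z) = a \<and> stat_last (snd z) = b. pair_weight z"
  let ?V = "\<lambda>c. vanishing (positions k N) P (coord_weight k p m \<circ> place c) (firsts k) (lasts k N) weight"
  have "(\<forall>t\<in>?B. \<forall>t'\<in>?B. total_corr t t' \<tau> = 0) \<longleftrightarrow> (\<forall>a\<in>?B. \<forall>b\<in>?B. ?R \<tau> a b = 0)" for \<tau>
    unfolding total_corr_def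
  proof (rule Fourier_vanishing_iff[OF p finite_matched_pairs])
    fix z assume "z \<in> matched_pairs \<tau>"
    then have "fst z \<in> points k p m" "snd z \<in> points k p m" unfolding matched_pairs_def by auto
    then show "stat_last (fst z) \<in> ?B" "stat_last (snd z) \<in> ?B" using stat_last_mem by blast+
  qed
  then have "is_CCC K L (codes k p m n jl \<pi> f) \<longleftrightarrow> (\<forall>\<tau>. \<tau> \<noteq> 0 \<longrightarrow> (\<forall>a\<in>?B. \<forall>b\<in>?B. ?R \<tau> a b = 0))"
    unfolding is_CCC_iff_total_corr by simp
  also have "\<dots> \<longleftrightarrow> (\<forall>c\<in>block_vecs k p n. ?V c)"
  proof
    assume V: "\<forall>c\<in>block_vecs k p n. ?V c"
    show "\<forall>\<tau>. \<tau> \<noteq> 0 \<longrightarrow> (\<forall>a\<in>?B. \<forall>b\<in>?B. ?R \<tau> a b = 0)"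
    proof (intro allI impI ballI)
      fix \<tau> :: int and a b assume \<tau>: "\<tau> \<noteq> 0" and a: "a \<in> ?B" and b: "b \<in> ?B"
      obtain c \<alpha> where c: "c \<in> block_vecs k p n" "a = extend c \<alpha>" using a by (rule extend_cases)
      obtain c' \<beta> where c': "c' \<in> block_vecs k p n" "b = extend c' \<beta>" using b by (rule extend_cases)
      show "?R \<tau> a b = 0"
      proof (cases "c = c'")
        case True
        have "?R \<tau> a b = pair_corr (positions k N) P (coord_weight k p m \<circ> place c) (firsts k) (lasts k N) weight \<tau> \<alpha> \<beta>"
          unfolding c(2) c'(2) True by (rule sum_matched_pairs_eq_pair_corr[OF c'(1)])
        then show ?thesis using V c(1) \<tau> unfolding vanishing_def by simp
      next
        case False
        \<comment> \<open>Matched points share \<open>stat_first\<close>, which contains the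
          restricted values; they cannot lie in different fibres.\<close>
        have "z \<notin> matched_pairs \<tau> \<or> stat_last (fst z) \<noteq> a \<or> stat_last (snd z) \<noteq> b" for z
        proof (rule ccontr)
          assume *: "\<not> ?thesis"
          obtain x y where z: "z = (x, y)" by (cases z)
          have xy: "x \<in> points k p m" "y \<in> points k p m" "stat_first x = stat_first y" "stat_last x = a" "stat_last y = b"
            using * unfolding z matched_pairs_def by auto
          have f: "x \<in> fibre c" "y \<in> fibre c'"
            using stat_last_eq_extend_iff[OF c(1) xy(1)] stat_last_eq_extend_iff[OF c'(1) xy(2)] xy(4,5) c(2) c'(2) by auto
          have "c = c'"
          proof (rule block_vecs_eqI[OF c(1) c'(1)])
            fix i j assume ij: "i \<in> {1..k}" "j \<in> {1..n i}"
            have "x (jl i j) = y (jl i j)" using stat_apply(1)[OF ij, of "\<lambda>_. 1"] xy(3) by metis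
            then show "c i j = c' i j" using fibreD(3)[OF f(1) ij] fibreD(3)[OF f(2) ij] by simp
          qed
          then show False using False by blast
        qed
        then show ?thesis by (intro sum.neutral) blast
      qed
    qed
  next
    assume R: "\<forall>\<tau>. \<tau> \<noteq> 0 \<longrightarrow> (\<forall>a\<in>?B. \<forall>b\<in>?B. ?R \<tau> a b = 0)"
    show "\<forall>c\<in>block_vecs k p n. ?V c" unfolding vanishing_def
    proof (intro ballI allI impI)
      fix c \<tau> \<alpha> \<beta> assume c: "c \<in> block_vecs k p n" and \<tau>: "(\<tau>::int) \<noteq> 0"
      let ?N = "pair_corr (positions k N) P (coord_weight k p m \<circ> place c) (firsts k) (lasts k N) weight \<tau> \<alpha> \<beta>"
      show "?N = 0"
      proof (cases "extend c \<alpha> \<in> ?B \<and> extend c \<beta> \<in> ?B")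
        case True
        then have "?R \<tau> (extend c \<alpha>) (extend c \<beta>) = 0" using R \<tau> by blast
        then show ?thesis unfolding sum_matched_pairs_eq_pair_corr[OF c] .
      next
        case False
        \<comment> \<open>A prescription out of range is never a value of \<open>stat_last\<close>,
          so both sums are empty.\<close>
        have "z \<notin> matched_pairs \<tau> \<or> stat_last (fst z) \<noteq> extend c \<alpha> \<or> stat_last (snd z) \<noteq> extend c \<beta>" for z
          using False stat_last_mem[of "fst z"] stat_last_mem[of "snd z"] unfolding matched_pairs_def by auto
        then have "?R \<tau> (extend c \<alpha>) (extend c \<beta>) = 0" by (intro sum.neutral) blast
        then show ?thesis unfolding sum_matched_pairs_eq_pair_corr[OF c] .
      qed
    qed
  qed
  finally show ?thesis .
qed

text \<open>The edge matrices do not depend on \<open>c\<close>, so all fibres yield the same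
  condition, and there is at least one fibre.\<close>

theorem is_CCC_iff_permutes_mod:
  "is_CCC K L (codes k p m n jl \<pi> f) \<longleftrightarrow>
    (\<forall>i\<in>{1..k}. \<forall>j\<in>{1..<N i}. permutes_mod (p i) (fij i j) \<and> permutes_mod (p i) (fij' i j))"
proof -
  have "vanishing (positions k N) P (coord_weight k p m \<circ> place c) (firsts k) (lasts k N) weight \<longleftrightarrow>
    (\<forall>i\<in>{1..k}. \<forall>j\<in>{1..<N i}. column_orth (p i) (edge_matrix i j))" if "c \<in> block_vecs k p n" for c
  proof (rule vanishing_chain)
    show "dissociated (positions k N) P (coord_weight k p m \<circ> place c)" by (rule dissociated_lift[OF that])
    show "row_orth (p i) (edge_matrix i j)" if "i \<in> {1..k}" "column_orth (p i) (edge_matrix i j)" for i j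
      by (rule row_orth_edge_matrix[OF that])
  qed (use p N_pos in \<open>auto simp: start_phase_def edge_matrix_def norm_power\<close>)
  then show ?thesis
    unfolding is_CCC_iff_vanishing using nonempty_block_vecs[of k p n] p column_orth_edge_matrix by auto
qed

end

theorem corollary3:
  fixes k q L K :: nat and p m n :: "nat \<Rightarrow> nat"
    and J :: "nat \<Rightarrow> nat set" and jl :: "nat \<Rightarrow> nat \<Rightarrow> nat"
    and \<pi> :: "nat \<Rightarrow> nat \<Rightarrow> nat \<Rightarrow> nat"
    and fij fij' gij :: "nat \<Rightarrow> nat \<Rightarrow> nat \<Rightarrow> nat"
    and fi hi :: "nat \<Rightarrow> nat \<Rightarrow> nat" and lam :: "nat \<Rightarrow> nat"
    and f :: "(nat \<Rightarrow> nat) \<Rightarrow> nat"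
  assumes "3 \<le> k"
    and "\<forall>i\<in>{1..k}. prime (p i)" and "strict_mono_on {1..k} p"
    and "q = (\<Prod>i=1..k. p i)"
    and "\<forall>i\<in>{1..k}. 2 \<le> m i \<and> n i \<le> m i - 1"
    and "L = (\<Prod>i=1..k. p i ^ m i)" and "K = (\<Prod>i=1..k. p i ^ (n i + 1))"
    and "\<forall>i\<in>{1..k}. J i \<subseteq> block m i \<and> card (J i) = n i \<and> bij_betw (jl i) {1..n i} (J i)"
    and "\<forall>i\<in>{1..k}. \<forall>j\<in>{1..m i - n i - 1}.
           fij i j \<in> {..<q} \<rightarrow> {..<q} \<and> fij' i j \<in> {..<q} \<rightarrow> {..<q}"
    and "\<forall>i\<in>{1..k}. \<forall>j\<in>{1..m i - n i}. gij i j \<in> {..<q} \<rightarrow> {..<q}"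
    and "\<forall>i\<in>{1..k - 1}. fi i \<in> {..<q} \<rightarrow> {..<q} \<and> hi i \<in> {..<q} \<rightarrow> {..<q} \<and> lam i < q"
    and "\<forall>i\<in>{1..k}. \<forall>c\<in>block_vecs k p n.
           \<pi> i (label k p n c) \<in> {1..m i - n i} \<rightarrow> block m i - J i \<and>
           inj_on (\<pi> i (label k p n c)) {1..m i - n i}"
    and "\<forall>c\<in>block_vecs k p n. \<forall>x\<in>points k p m.
           (\<forall>i\<in>{1..k}. \<forall>j\<in>{1..n i}. x (jl i j) = c i j) \<longrightarrow>
           (let \<sigma> = (\<lambda>i. \<pi> i (label k p n c)) in
            f x =
              ((\<Sum>i=1..k.
                  q div p i *
                    (\<Sum>j=1..m i - n i - 1. fij i j (x (\<sigma> i j)) * fij' i j (x (\<sigma> i (j + 1))))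
                  + (\<Sum>j=1..m i - n i. gij i j (x (\<sigma> i j))))
               + (\<Sum>i=1..k - 1. lam i * fi i (x (\<sigma> i (m i - n i))) * hi i (x (\<sigma> (i + 1) 1))))
              mod q)"
  shows "is_CCC K L (codes k p m n jl \<pi> f) \<longleftrightarrow>
         (\<forall>i\<in>{1..k}. \<forall>j\<in>{1..m i - n i - 1}.
            permutes_mod (p i) (fij i j) \<and> permutes_mod (p i) (fij' i j))"
proof -
  interpret path_codes k q p m n J jl \<pi> fij fij' gij fi hi lam f
  proof
    fix i assume i: "i \<in> {1..k}"
    show "0 < p i" using assms(2) i by (simp add: prime_gt_0_nat)
    show "n i < m i" using assms(5) i by fastforce
    show "J i \<subseteq> block m i" "bij_betw (jl i) {1..n i} (J i)" using assms(8) i by blast+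
    fix c assume c: "c \<in> block_vecs k p n"
    let ?g = "\<pi> i (label k p n c)"
    have g: "?g ` {1..m i - n i} \<subseteq> block m i - J i" "inj_on ?g {1..m i - n i}" using assms(12) i c by blast+
    have fin: "finite (block m i)" unfolding block_def by simp
    \<comment> \<open>An injection between finite sets of equal size is onto, so each path visits
      every free coordinate of its block.\<close>
    have "card (block m i - J i) = m i - n i"
      using card_Diff_subset[of "J i" "block m i"] assms(8) i finite_subset[OF _ fin] by (simp add: block_def)
    then have "?g ` {1..m i - n i} = block m i - J i"
      using card_image[OF g(2)] fin by (intro card_subset_eq[OF _ g(1)]) auto
    with g(2) show "bij_betw ?g {1..m i - n i} (block m i - J i)" unfolding bij_betw_def by blast
  next
    fix c x assume "c \<in> block_vecs k p n" "x \<in> points k p m"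
      and "\<And>i j. i \<in> {1..k} \<Longrightarrow> j \<in> {1..n i} \<Longrightarrow> x (jl i j) = c i j"
    then show "f x = ((\<Sum>i=1..k.
          q div p i * (\<Sum>j=1..m i - n i - 1. fij i j (x (\<pi> i (label k p n c) j)) * fij' i j (x (\<pi> i (label k p n c) (j + 1))))
          + (\<Sum>j=1..m i - n i. gij i j (x (\<pi> i (label k p n c) j))))
        + (\<Sum>i=1..k - 1. lam i * fi i (x (\<pi> i (label k p n c) (m i - n i))) * hi i (x (\<pi> (i + 1) (label k p n c) 1))))
        mod q"
      using assms(13)[unfolded Let_def] by blast
  qed (rule assms(4))
  have "{1..<m i - n i} = {1..m i - n i - 1}" for i by auto
  then show ?thesis using is_CCC_iff_permutes_mod unfolding assms(6,7) by simp
qed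

end
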